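(* Let $p<q$ be primes with $p$ odd, and let $\beta\in[1,p-1]$ with $q\equiv\beta\pmod p$. Let $\beta^*\in[1,p-1]$ be the inverse of $\beta$ modulo $p$. Then $M(p;q)\le M_\beta(p)\le m(\beta^* )$.
   Context: For a positive integer $n$, write the $n$-th cyclotomic polynomial as $\Phi_n(x)=\sum_{k=0}^{\varphi(n)}a_n(k)x^k$ and let its height be $A(n)=\max_k|a_n(k)|$. For an odd prime $p$ and a prime $q>p$, let $M(p;q)=\max\{A(pqr): r \text{ prime}, r>q\}$. For $1\le\beta\le p-1$, let $M_\beta(p)=\max\{M(p;q): q>p \text{ prime},\ q\equiv\beta \pmod p\}$ (this maximum exists). For $1\le j\le p-1$, define $w(j)=\frac{p-1}{2}+j$ if $j<\frac p4$; $w(j)=p-j$ if $\frac p4<j\le\frac{p-1}{2}$; $w(j)=w(p-j)$ if $j>\frac{p-1}{2}$; and $m(j)=\min\{w(j),\lfloor\frac{2}{3}p\rfloor\}$. *)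

theory Defs
  imports
    Complex_Main
    "HOL-Computational_Algebra.Polynomial"
    "HOL-Number_Theory.Totient"
begin

text \<open>
  The monic polynomial whose roots are the primitive \<open>n\<close>-th roots of unity, for \<open>n > 0\<close>.
  Its coefficients are integers, but it is kept as a complex polynomial, so that heights
  are maxima of complex moduli and hence real numbers.
\<close>

definition cyclotomic :: "nat \<Rightarrow> complex poly" where
  "cyclotomic n = (\<Prod>k\<in>totatives n. [:- cis (2 * pi * real k / real n), 1:])"

definition height :: "nat \<Rightarrow> real" where
  "height n = Max {cmod (coeff (cyclotomic n) k) |k. k \<le> totient n}"

text \<open>
  The next two maxima range over infinitely many primes. \<^const>\<open>Max\<close> is applied to the set
  of attained values, on which it is meaningful because only finitely many values occur.
\<close>

definition max_height_pq :: "nat \<Rightarrow> nat \<Rightarrow> real" where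
  "max_height_pq p q = Max {height (p * q * r) |r. prime r \<and> r > q}"

definition max_height_residue :: "nat \<Rightarrow> nat \<Rightarrow> real" where
  "max_height_residue \<beta> p = Max {max_height_pq p q |q. prime q \<and> q > p \<and> [q = \<beta>] (mod p)}"

text \<open>
  The recursion \<open>w(j) = w(p - j)\<close> for \<open>j > (p - 1) / 2\<close> is unrolled once: for
  \<open>j \<le> p - 1\<close> the argument \<open>p - j\<close> falls into one of the other two cases. The value
  \<open>j = p / 4\<close> does not occur for odd \<open>p\<close>.
\<close>

definition w_low :: "nat \<Rightarrow> nat \<Rightarrow> real" where
  "w_low p j = (if real j < real p / 4 then (real p - 1) / 2 + real j else real p - real j)"

definition w_bound :: "nat \<Rightarrow> nat \<Rightarrow> real" where
  "w_bound p j = (if real j \<le> (real p - 1) / 2 then w_low p j else w_low p (p - j))"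

definition m_bound :: "nat \<Rightarrow> nat \<Rightarrow> real" where
  "m_bound p j = min (w_bound p j) (real_of_int \<lfloor>2 / 3 * real p\<rfloor>)"

end

theory Submission
  imports Defs "HOL-Computational_Algebra.Fundamental_Theorem_Algebra"
begin

text \<open>
  For \<open>n < N = p q r\<close> the \<open>n\<close>-th coefficient is the sum over \<open>0 \<le> m < p\<close> of
  \<open>\<chi>(n - m) - \<chi>(n - m - q) - \<chi>(n - m - r) + \<chi>(n - m - q - r)\<close>, where \<open>\<chi>\<close> is the indicator of the
  numbers \<open>x q r + y p r + z p q\<close> with digits \<open>x < p\<close>, \<open>y < q\<close>, \<open>z < r\<close>. The digits of
  \<open>k\<close> modulo \<open>N\<close> satisfy \<open>x q r + y p r + z p q = k + G N\<close>, and \<open>\<chi>(k) = 1\<close> iff \<open>G = 0\<close>. A shift by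
  \<open>q\<close> or \<open>r\<close> moves \<open>x\<close> by the inverse of \<open>r\<close> or \<open>q\<close> modulo \<open>p\<close>; up to sign one may replace these
  inverses by their distances \<open>s, t < p / 2\<close> to the multiples of \<open>p\<close>. Put \<open>\<alpha> = min s t\<close>,
  \<open>\<beta> = max s t\<close>. As \<open>m\<close> varies, \<open>x\<close> takes every value once, and the summand is at most 1, where the
  value 1 needs \<open>x < \<alpha>\<close> (type \<open>A\<close> or \<open>H\<close>) or \<open>x \<ge> \<alpha> + \<beta>\<close> (type \<open>P\<close>); points of type \<open>P\<close>
  lie in a window of length \<open>\<alpha> + \<beta>\<close>. This gives Bzdega's bounds \<open>p - \<beta>\<close> and
  \<open>2 \<alpha> + \<beta>\<close>, hence \<open>w\<close>.

  If the sum exceeded \<open>2 p / 3\<close>, then \<open>3 \<beta> < p\<close> and nearly all \<open>x\<close> of these two kinds would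
  contribute. Since \<open>y\<close> and \<open>z\<close> stay in arcs shorter than a third of the circle on \<open>P\<close>,
  differences of points of \<open>P\<close> add up without wrap-around. Comparing them with differences between
  type \<open>A\<close> and the interval \<open>{\<beta>..<\<alpha>+\<beta>}\<close>, where the summand is -1 or 0, shows that the index
  \<open>m\<close> is an affine function of \<open>x\<close> on \<open>P\<close>, with a slope of absolute value at most 2. Hence \<open>y\<close> and \<open>z\<close> are
  monotone along \<open>P\<close>, and continuing this progression from \<open>P\<close> across \<open>x = 0\<close> to type \<open>A\<close> is
  impossible.
\<close>

section \<open>Counting along an arithmetic progression on a torus\<close>

text \<open>
  The point with first coordinate \<open>x\<close> is the element \<open>n - m\<close> of the block with \<open>m = idx x\<close>. The
  other two coordinates are measured downwards from the top: \<open>\<eta> = N - p r - p r y\<close> and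
  \<open>\<zeta> = N - p q - p q z\<close>, scaled such that one unit of \<open>x\<close> corresponds to \<open>U = q r\<close>.
\<close>

locale shifted_count =
  fixes p U K s t ay az \<mu> \<delta> \<eta>0 \<theta> \<zeta>0 \<phi> :: int and G :: "int \<Rightarrow> int"
  assumes p_odd: "odd p" and p_less_U: "p < U"
    and s_pos: "1 \<le> s" and t_pos: "1 \<le> t" and s_half: "2 * s < p" and t_half: "2 * t < p"
    and ay: "0 \<le> ay" "ay + p \<le> t * U" and az: "0 \<le> az" "az + p \<le> s * U"
    and dvd_\<delta>: "p dvd \<delta> * s * t - 1 \<or> p dvd \<delta> * s * t + 1"
    and balance: "\<And>x. 0 \<le> x \<Longrightarrow> x < p \<Longrightarrow>
       x * U = K - (\<mu> + \<delta> * x) mod p + (\<eta>0 + \<theta> * ((\<mu> + \<delta> * x) mod p)) mod (p * U)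
             + (\<zeta>0 + \<phi> * ((\<mu> + \<delta> * x) mod p)) mod (p * U) + (G x - 2) * (p * U)"
    and G_nonneg: "\<And>x. 0 \<le> x \<Longrightarrow> x < p \<Longrightarrow> 0 \<le> G x"
    and Gs_nonneg: "\<And>x. 0 \<le> x \<Longrightarrow> x < p \<Longrightarrow> 0 \<le> G x - 1 + of_bool (x < s)
        + of_bool (az < (\<zeta>0 + \<phi> * ((\<mu> + \<delta> * x) mod p)) mod (p * U))"
    and Gt_nonneg: "\<And>x. 0 \<le> x \<Longrightarrow> x < p \<Longrightarrow> 0 \<le> G x - 1 + of_bool (x < t)
        + of_bool (ay < (\<eta>0 + \<theta> * ((\<mu> + \<delta> * x) mod p)) mod (p * U))"
    and Gst_nonneg: "\<And>x. 0 \<le> x \<Longrightarrow> x < p \<Longrightarrow> 0 \<le> G x - 2 + of_bool (x < t)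
        + of_bool (ay < (\<eta>0 + \<theta> * ((\<mu> + \<delta> * x) mod p)) mod (p * U))
        + of_bool ((x - t) mod p < s)
        + of_bool (az < (\<zeta>0 + \<phi> * ((\<mu> + \<delta> * x) mod p)) mod (p * U))"
begin

definition N :: int where "N = p * U"
definition idx :: "int \<Rightarrow> int" where "idx x = (\<mu> + \<delta> * x) mod p"
definition \<eta> :: "int \<Rightarrow> int" where "\<eta> x = (\<eta>0 + \<theta> * idx x) mod N"
definition \<zeta> :: "int \<Rightarrow> int" where "\<zeta> x = (\<zeta>0 + \<phi> * idx x) mod N"
definition yl :: "int \<Rightarrow> bool" where "yl x \<longleftrightarrow> ay < \<eta> x"
definition zl :: "int \<Rightarrow> bool" where "zl x \<longleftrightarrow> az < \<zeta> x"
definition both :: "int \<Rightarrow> bool" where "both x \<longleftrightarrow> \<eta> x \<le> ay \<and> \<zeta> x \<le> az"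
definition f :: "int \<Rightarrow> int" where
  "f x = of_bool (G x = 0) - of_bool (G x - 1 + of_bool (x < s) + of_bool (zl x) = 0)
       - of_bool (G x - 1 + of_bool (x < t) + of_bool (yl x) = 0)
       + of_bool (G x - 2 + of_bool (x < t) + of_bool (yl x) + of_bool ((x - t) mod p < s)
                  + of_bool (zl x) = 0)"
definition T :: int where "T = (\<Sum>x\<in>{0..<p}. f x)"
definition \<alpha> :: int where "\<alpha> = min s t"
definition \<beta> :: int where "\<beta> = max s t"

definition A :: "int set" where "A = {x\<in>{0..<\<alpha>}. G x = 0 \<and> \<not> both x}"
definition H :: "int set" where "H = {x\<in>{0..<\<alpha>}. G x = 1 \<and> both x}"
definition P :: "int set" where "P = {x\<in>{\<alpha>+\<beta>..<p}. G x = 2 \<and> both x}"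
definition Neg :: "int set" where
  "Neg = {x\<in>{\<beta>..<\<alpha>+\<beta>}. if yl x \<and> zl x then G x = 0 else G x = 1}"

lemma p_ge: "3 \<le> p" using s_pos s_half by linarith
lemma U_pos: "0 < U" using p_ge p_less_U by linarith
lemma N_pos: "0 < N" using p_ge U_pos by (simp add: N_def)

lemma \<alpha>_pos: "1 \<le> \<alpha>" and \<alpha>_le_\<beta>: "\<alpha> \<le> \<beta>" and \<beta>_half: "2 * \<beta> < p" and \<alpha>\<beta>: "\<alpha> + \<beta> = s + t"
  using s_pos t_pos s_half t_half by (auto simp: \<alpha>_def \<beta>_def)

lemma ay_\<beta>: "ay + p \<le> \<beta> * U" and az_\<beta>: "az + p \<le> \<beta> * U"
proof -
  have "t * U \<le> \<beta> * U" "s * U \<le> \<beta> * U" using U_pos by (auto simp: \<beta>_def)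
  thus "ay + p \<le> \<beta> * U" "az + p \<le> \<beta> * U" using ay az by linarith+
qed

lemma idx_range: "0 \<le> idx x" "idx x < p" using p_ge by (auto simp: idx_def)
lemma \<eta>_range: "0 \<le> \<eta> x" "\<eta> x < N" and \<zeta>_range: "0 \<le> \<zeta> x" "\<zeta> x < N"
  using N_pos by (auto simp: \<eta>_def \<zeta>_def)

lemma balance_eq: "0 \<le> x \<Longrightarrow> x < p \<Longrightarrow> x * U = K - idx x + \<eta> x + \<zeta> x + (G x - 2) * N"
  using balance[of x] by (simp add: idx_def \<eta>_def \<zeta>_def N_def)

lemma G1: "0 \<le> x \<Longrightarrow> x < p \<Longrightarrow> 0 \<le> G x - 1 + of_bool (x < s) + of_bool (zl x)"
  and G2: "0 \<le> x \<Longrightarrow> x < p \<Longrightarrow> 0 \<le> G x - 1 + of_bool (x < t) + of_bool (yl x)"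
  and G3: "0 \<le> x \<Longrightarrow> x < p \<Longrightarrow> 0 \<le> G x - 2 + of_bool (x < t) + of_bool (yl x)
             + of_bool ((x - t) mod p < s) + of_bool (zl x)"
  using Gs_nonneg[of x] Gt_nonneg[of x] Gst_nonneg[of x]
  by (auto simp: idx_def \<eta>_def \<zeta>_def yl_def zl_def N_def)

section \<open>Values of the summand on the ranges of \<open>x\<close>\<close>

lemma both_iff: "both x \<longleftrightarrow> \<not> yl x \<and> \<not> zl x" by (auto simp: both_def yl_def zl_def)

lemma mod_shift:
  assumes "0 \<le> x" "x < p"
  shows "(x - t) mod p = (if x < t then x - t + p else x - t)"
proof (cases "x < t")
  case True
  have "(x - t) mod p = (x - t + p) mod p" by simp
  also have "\<dots> = x - t + p" using True assms t_half t_pos by (intro mod_pos_pos_trivial) auto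
  finally show ?thesis using True by simp
next
  case False
  thus ?thesis using assms t_pos by (auto intro!: mod_pos_pos_trivial)
qed

text \<open>Here \<open>x\<close> is below \<open>s\<close> and \<open>t\<close>, and
  \<open>x - t\<close> wraps to a digit not below \<open>s\<close>, since \<open>s + t < p\<close>.
  If neither other digit is low, \<open>G3\<close> forces \<open>G x \<ge> 1\<close> and only
  \<open>G x = 1\<close> contributes; otherwise the indicators reduce to that of
  \<open>G x = 0\<close>.\<close>

lemma f_low: "x \<in> {0..<\<alpha>} \<Longrightarrow> f x = of_bool (x \<in> A \<union> H)"
  using G_nonneg[of x] G1[of x] G2[of x] G3[of x] s_half t_half mod_shift[of x]
  by (auto simp: f_def \<alpha>_def A_def H_def both_iff split: if_splits)

lemma f_mid: "x \<in> {\<alpha>..<\<beta>} \<Longrightarrow> - 1 \<le> f x \<and> f x \<le> 0"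
  using G_nonneg[of x] G1[of x] G2[of x] G3[of x] s_half t_half mod_shift[of x] s_pos t_pos
  by (cases "yl x"; cases "zl x"; cases "s \<le> t"; auto simp: f_def \<alpha>_def \<beta>_def split: if_splits)

text \<open>Now \<open>x - t < s\<close> although \<open>x\<close> is at least \<open>s\<close> and
  \<open>t\<close>, so only the last indicator sees a borrow in the first digit. At the smallest
  \<open>G x\<close> that \<open>G_nonneg\<close>, \<open>G1\<close> and \<open>G2\<close> allow,
  the value is -1.\<close>

lemma f_neg: "x \<in> {\<beta>..<\<alpha>+\<beta>} \<Longrightarrow> f x = - of_bool (x \<in> Neg)"
  using G_nonneg[of x] G1[of x] G2[of x] G3[of x] s_half t_half mod_shift[of x] s_pos t_pos \<alpha>\<beta>
  by (cases "yl x"; cases "zl x"; auto simp: f_def \<beta>_def Neg_def split: if_splits)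

text \<open>No borrow occurs in the first digit. If another digit is low, the indicators cancel; if
  none is, \<open>G3\<close> forces \<open>G x \<ge> 2\<close> and only the last indicator can
  survive.\<close>

lemma f_high: "x \<in> {\<alpha>+\<beta>..<p} \<Longrightarrow> f x = of_bool (x \<in> P)"
  using G_nonneg[of x] G1[of x] G2[of x] G3[of x] s_half t_half mod_shift[of x] s_pos t_pos
  unfolding \<alpha>\<beta> P_def
  by (cases "yl x"; cases "zl x"; auto simp: f_def both_iff split: if_splits)

lemma sum_ivl_split: "a \<le> b \<Longrightarrow> b \<le> c \<Longrightarrow> sum g {a..<c} = sum g {a..<b} + sum g {b..<c}"
  for a b c :: int and g :: "int \<Rightarrow> int"
  by (subst sum.union_disjoint[symmetric]) (auto intro!: sum.cong)

lemma T_split: "T = (\<Sum>x\<in>{0..<\<alpha>}. f x) + (\<Sum>x\<in>{\<alpha>..<\<beta>}. f x) + (\<Sum>x\<in>{\<beta>..<\<alpha>+\<beta>}. f x) + (\<Sum>x\<in>{\<alpha>+\<beta>..<p}. f x)"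
  using sum_ivl_split[of 0 \<alpha> p f] sum_ivl_split[of \<alpha> \<beta> p f] sum_ivl_split[of \<beta> "\<alpha>+\<beta>" p f]
    \<alpha>_pos \<alpha>_le_\<beta> \<beta>_half by (simp add: T_def)

lemma sum_of_bool_mem: "finite B \<Longrightarrow> C \<subseteq> B \<Longrightarrow> (\<Sum>x\<in>B. of_bool (x \<in> C)) = int (card C)"
  by (simp add: sum.If_cases of_bool_def Int_absorb1)

lemma T_le: "T \<le> int (card (A \<union> H)) + int (card P) - int (card Neg)"
proof -
  have 1: "(\<Sum>x\<in>{0..<\<alpha>}. f x) = int (card (A \<union> H))"
    by (subst sum_of_bool_mem[symmetric, of "{0..<\<alpha>}"]) (auto simp: f_low A_def H_def intro!: sum.cong)
  have 2: "(\<Sum>x\<in>{\<alpha>..<\<beta>}. f x) \<le> 0" using f_mid by (auto intro: sum_nonpos)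
  have 3: "(\<Sum>x\<in>{\<beta>..<\<alpha>+\<beta>}. f x) = - int (card Neg)"
  proof -
    have "(\<Sum>x\<in>{\<beta>..<\<alpha>+\<beta>}. f x) = (\<Sum>x\<in>{\<beta>..<\<alpha>+\<beta>}. - of_bool (x \<in> Neg))"
      using f_neg by (intro sum.cong) auto
    also have "\<dots> = - int (card Neg)"
      unfolding sum_negf by (subst sum_of_bool_mem) (auto simp: Neg_def)
    finally show ?thesis .
  qed
  have 4: "(\<Sum>x\<in>{\<alpha>+\<beta>..<p}. f x) = int (card P)"
    by (subst sum_of_bool_mem[symmetric, of "{\<alpha>+\<beta>..<p}"]) (auto simp: f_high P_def intro!: sum.cong)
  show ?thesis using T_split 1 2 3 4 by linarith
qed

text \<open>Needed for absolute values: only the \<open>\<beta>\<close> places of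
  \<open>{\<alpha>..<\<alpha>+\<beta>}\<close> can count negatively.\<close>

lemma T_ge: "- \<beta> \<le> T"
proof -
  have 1: "(\<Sum>x\<in>{0..<\<alpha>}. f x) \<ge> 0" "(\<Sum>x\<in>{\<alpha>+\<beta>..<p}. f x) \<ge> 0"
    using f_low f_high by (auto intro!: sum_nonneg)
  have "(\<Sum>x\<in>{\<alpha>..<\<beta>}. f x) \<ge> (\<Sum>x\<in>{\<alpha>..<\<beta>}. - 1)" using f_mid by (intro sum_mono) auto
  moreover have "(\<Sum>x\<in>{\<beta>..<\<alpha>+\<beta>}. f x) \<ge> (\<Sum>x\<in>{\<beta>..<\<alpha>+\<beta>}. - 1)"
    using f_neg by (intro sum_mono) auto
  ultimately show ?thesis using 1 T_split \<alpha>_le_\<beta> \<alpha>_pos by auto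
qed

section \<open>The window of \<open>P\<close> and the first two upper bounds\<close>

text \<open>The least \<open>x\<close> with \<open>x * U > K - p\<close>. By the balance with
  \<open>G x = 2\<close>, no point of \<open>P\<close> lies below it.\<close>

definition \<omega> :: int where "\<omega> = (K - p + U) div U"

lemma \<omega>_le: "K - p + 1 \<le> x * U \<Longrightarrow> \<omega> \<le> x"
proof -
  assume "K - p + 1 \<le> x * U"
  hence "K - p + U < (x + 1) * U" by (simp add: algebra_simps)
  moreover have "\<omega> * U + (K - p + U) mod U = K - p + U"
    unfolding \<omega>_def by (rule div_mult_mod_eq)
  moreover have "0 \<le> (K - p + U) mod U" using U_pos by (rule pos_mod_sign)
  ultimately have "\<omega> * U < (x + 1) * U" by linarith
  hence "\<omega> < x + 1" using U_pos by (simp only: mult_less_cancel_right_pos)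
  thus ?thesis by simp
qed

text \<open>The bounds on \<open>ay\<close> and \<open>az\<close> add up to
  \<open>ay + az + 2 * p \<le> (\<alpha> + \<beta>) * U\<close>, which limits the length of the
  window.\<close>

lemma \<omega>_greater: "x * U \<le> K + ay + az \<Longrightarrow> x < \<omega> + \<alpha> + \<beta>"
proof -
  assume a: "x * U \<le> K + ay + az"
  have "K - p + U = \<omega> * U + (K - p + U) mod U"
    unfolding \<omega>_def by (simp only: div_mult_mod_eq)
  moreover have "(K - p + U) mod U < U" using U_pos by simp
  ultimately have "K - p < \<omega> * U" by linarith
  hence "x * U < (\<omega> + s + t) * U" using a ay az p_ge by (simp add: algebra_simps)
  thus ?thesis using U_pos \<alpha>\<beta> by simp
qed

lemma P_window: "x \<in> P \<Longrightarrow> x \<in> {max (\<alpha>+\<beta>) \<omega>..<min p (\<omega>+\<alpha>+\<beta>)}"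
proof -
  assume x: "x \<in> P"
  hence r: "0 \<le> x" "x < p" "\<alpha> + \<beta> \<le> x" using \<alpha>_pos \<alpha>_le_\<beta> by (auto simp: P_def)
  have "x * U = K - idx x + \<eta> x + \<zeta> x" using balance_eq[OF r(1,2)] x by (simp add: P_def)
  hence "K - p + 1 \<le> x * U" "x * U \<le> K + ay + az"
    using idx_range[of x] \<eta>_range[of x] \<zeta>_range[of x] x unfolding P_def both_def by auto
  thus ?thesis using \<omega>_le \<omega>_greater r by auto
qed

text \<open>For \<open>G x = 1\<close> the balance at \<open>x + p\<close> is the one of a point of
  \<open>P\<close>, so the same upper end applies.\<close>

lemma H_window: "x \<in> H \<Longrightarrow> x + p < \<omega> + \<alpha> + \<beta>"
proof -
  assume x: "x \<in> H"
  hence r: "0 \<le> x" "x < p" using \<alpha>_pos \<alpha>_le_\<beta> \<beta>_half by (auto simp: H_def)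
  have "x * U = K - idx x + \<eta> x + \<zeta> x - N" using balance_eq[OF r(1,2)] x by (simp add: H_def)
  hence "(x + p) * U \<le> K + ay + az"
    using idx_range[of x] x unfolding H_def both_def by (auto simp: algebra_simps N_def)
  thus ?thesis using \<omega>_greater by auto
qed

text \<open>Low places contribute at most \<open>\<alpha>\<close>. For \<open>P\<close>, the
  interval \<open>{\<alpha>+\<beta>..<p}\<close> gives the first bound and the window the
  second.\<close>

lemma T_le_diff: "T \<le> p - \<beta>" and T_le_sum: "T \<le> 2 * \<alpha> + \<beta>"
proof -
  have 1: "int (card (A \<union> H)) \<le> \<alpha>"
  proof -
    have "A \<union> H \<subseteq> {0..<\<alpha>}" by (auto simp: A_def H_def)
    hence "card (A \<union> H) \<le> card {0..<\<alpha>}" by (intro card_mono) auto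
    thus ?thesis using \<alpha>_pos by simp
  qed
  have 2: "int (card P) \<le> p - (\<alpha> + \<beta>)"
  proof -
    have "P \<subseteq> {\<alpha>+\<beta>..<p}" by (auto simp: P_def)
    hence "card P \<le> card {\<alpha>+\<beta>..<p}" by (intro card_mono) auto
    thus ?thesis using \<alpha>_le_\<beta> \<beta>_half by simp
  qed
  have "P \<subseteq> {\<omega>..<\<omega>+\<alpha>+\<beta>}" using P_window by auto
  hence "int (card P) \<le> int (card {\<omega>..<\<omega>+\<alpha>+\<beta>})" by (intro of_nat_mono card_mono) auto
  hence 3: "int (card P) \<le> \<alpha> + \<beta>" using \<alpha>_pos \<alpha>_le_\<beta> by simp
  show "T \<le> p - \<beta>" "T \<le> 2 * \<alpha> + \<beta>" using T_le 1 2 3 by linarith+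
qed

section \<open>Differences of points and parallelograms\<close>

lemma idx_cong: "p dvd idx y - idx x - \<delta> * (y - x)"
proof -
  have "p dvd idx z - (\<mu> + \<delta> * z)" for z by (simp add: idx_def mod_eq_dvd_iff[symmetric])
  from dvd_diff[OF this[of y] this[of x]] show ?thesis by (simp add: algebra_simps)
qed

lemma \<eta>_cong: "N dvd \<eta> y - \<eta> x - \<theta> * (idx y - idx x)"
  and \<zeta>_cong: "N dvd \<zeta> y - \<zeta> x - \<phi> * (idx y - idx x)"
proof -
  have "N dvd \<eta> z - (\<eta>0 + \<theta> * idx z)" "N dvd \<zeta> z - (\<zeta>0 + \<phi> * idx z)" for z
    by (simp_all add: \<eta>_def \<zeta>_def mod_eq_dvd_iff[symmetric])
  from dvd_diff[OF this(1)[of y] this(1)[of x]] dvd_diff[OF this(2)[of y] this(2)[of x]]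
  show "N dvd \<eta> y - \<eta> x - \<theta> * (idx y - idx x)" "N dvd \<zeta> y - \<zeta> x - \<phi> * (idx y - idx x)"
    by (simp_all add: algebra_simps)
qed

lemma P_range: "x \<in> P \<Longrightarrow> 0 \<le> x \<and> x < p" using \<alpha>_pos \<alpha>_le_\<beta> by (auto simp: P_def)
lemma A_range: "x \<in> A \<Longrightarrow> 0 \<le> x \<and> x < p" using \<alpha>_le_\<beta> \<beta>_half \<alpha>_pos by (auto simp: A_def)
lemma P_bal: "x \<in> P \<Longrightarrow> x * U = K - idx x + \<eta> x + \<zeta> x"
  using balance_eq[of x] P_range[of x] by (auto simp: P_def)
lemma A_bal: "x \<in> A \<Longrightarrow> x * U = K - idx x + \<eta> x + \<zeta> x - 2 * N"
  using balance_eq[of x] A_range[of x] by (auto simp: A_def)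
lemma P_\<eta>: "x \<in> P \<Longrightarrow> y \<in> P \<Longrightarrow> \<bar>\<eta> y - \<eta> x\<bar> \<le> ay"
  and P_\<zeta>: "x \<in> P \<Longrightarrow> y \<in> P \<Longrightarrow> \<bar>\<zeta> y - \<zeta> x\<bar> \<le> az"
  using \<eta>_range[of x] \<eta>_range[of y] \<zeta>_range[of x] \<zeta>_range[of y] by (auto simp: P_def both_def)

lemma a_less_N: "2 * ay < N" "2 * az < N"
proof -
  have "2 * \<beta> * U < p * U" using \<beta>_half U_pos by simp
  thus "2 * ay < N" "2 * az < N" using ay_\<beta> az_\<beta> p_ge by (auto simp: N_def)
qed

text \<open>
  Adding the difference of two points of \<open>P\<close> to a point of \<open>A\<close> changes each of \<open>\<eta>\<close>, \<open>\<zeta>\<close> by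
  less than one wrap-around, and \<open>x < \<omega>\<close> rules out that both wrap. So the fourth vertex of such a
  parallelogram, if it is a point of the progression, is counted negatively.
\<close>

lemma parallelogram:
  assumes x1: "x1 \<in> A" and x: "x \<in> {\<beta>..<\<alpha>+\<beta>}" "x < \<omega>" "x \<notin> Neg" and q: "q \<in> P" and u: "u \<in> P"
    and eq: "x - x1 = u - q"
  shows "idx x - idx x1 \<noteq> idx u - idx q"
proof
  assume m: "idx x - idx x1 = idx u - idx q"
  have xr: "0 \<le> x" "x < p" using x \<beta>_half \<alpha>_le_\<beta> \<alpha>_pos by auto
  have "N dvd (\<eta> x - \<eta> x1) - (\<eta> u - \<eta> q)" "N dvd (\<zeta> x - \<zeta> x1) - (\<zeta> u - \<zeta> q)"
    using dvd_diff[OF \<eta>_cong[of x x1] \<eta>_cong[of u q]] dvd_diff[OF \<zeta>_cong[of x x1] \<zeta>_cong[of u q]]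
    by (simp_all add: m algebra_simps)
  then obtain i' j' where ij': "(\<eta> x - \<eta> x1) - (\<eta> u - \<eta> q) = N * i'" "(\<zeta> x - \<zeta> x1) - (\<zeta> u - \<zeta> q) = N * j'"
    by (auto elim!: dvdE)
  define i where "i = - i'"
  define j where "j = - j'"
  have ij: "\<eta> x = \<eta> x1 + (\<eta> u - \<eta> q) - N * i" "\<zeta> x = \<zeta> x1 + (\<zeta> u - \<zeta> q) - N * j"
    using ij' by (auto simp: i_def j_def)
  \<comment> \<open>In the balances at the four corners the first coordinates and the indices
    cancel, so \<open>G x\<close> is the total number of wrap-arounds.\<close>
  have "(x - x1) * U = (u - q) * U" using eq by simp
  hence "N * G x = N * (i + j)"
    using balance_eq[OF xr] A_bal[OF x1] P_bal[OF q] P_bal[OF u] m ij by (simp add: algebra_simps)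
  hence Gij: "G x = i + j" using N_pos by simp
  have i: "i \<le> 1 \<and> (i = 1 \<longrightarrow> \<not> yl x)"
  proof -
    have b: "N * i < N + ay" using ij(1) P_\<eta>[OF q u] \<eta>_range[of x] \<eta>_range[of x1] by linarith
    hence "N * i < N * 2" using a_less_N ay by linarith
    hence "i \<le> 1" using N_pos by simp
    moreover have "i = 1 \<Longrightarrow> \<eta> x \<le> ay" using ij(1) P_\<eta>[OF q u] \<eta>_range[of x1] by simp
    ultimately show ?thesis by (auto simp: yl_def)
  qed
  have j: "j \<le> 1 \<and> (j = 1 \<longrightarrow> \<not> zl x)"
  proof -
    have b: "N * j < N + az" using ij(2) P_\<zeta>[OF q u] \<zeta>_range[of x] \<zeta>_range[of x1] by linarith
    hence "N * j < N * 2" using a_less_N az by linarith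
    hence "j \<le> 1" using N_pos by simp
    moreover have "j = 1 \<Longrightarrow> \<zeta> x \<le> az" using ij(2) P_\<zeta>[OF q u] \<zeta>_range[of x1] by simp
    ultimately show ?thesis by (auto simp: zl_def)
  qed
  have st: "\<not> x < s" "\<not> x < t" using x by (auto simp: \<beta>_def)
  show False
  proof (cases "yl x \<and> zl x")
    case True
    hence "i \<le> 0" "j \<le> 0" using i j by auto
    hence "G x = 0" using Gij G_nonneg[OF xr] by simp
    thus False using True x by (auto simp: Neg_def)
  next
    case False
    hence "1 \<le> G x" using G1[OF xr] G2[OF xr] st by auto
    moreover have "G x \<noteq> 1" using False x by (auto simp: Neg_def)
    ultimately have "G x = 2" using Gij i j by linarith
    hence "x * U = K - idx x + \<eta> x + \<zeta> x" using balance_eq[OF xr] by simp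
    hence "K - p + 1 \<le> x * U" using idx_range[of x] \<eta>_range[of x] \<zeta>_range[of x] by linarith
    hence "\<omega> \<le> x" by (rule \<omega>_le)
    thus False using x by simp
  qed
qed

text \<open>
  All of \<open>P\<close> lies in \<open>{lo..<hi}\<close>. The numbers \<open>missP\<close> and \<open>missAQ\<close> count the places where the
  count falls short of \<open>p - \<beta>\<close>, apart from the \<open>p - \<alpha> - \<beta> - L\<close> places outside of this interval.
\<close>

definition lo :: int where "lo = max (\<alpha>+\<beta>) \<omega>"
definition hi :: int where "hi = min p (\<omega>+\<alpha>+\<beta>)"
definition L :: int where "L = hi - lo"
text \<open>\<open>B\<close> avoids the places where \<open>H_window\<close> admits type
  \<open>H\<close>; \<open>Q\<close> keeps the places below \<open>\<omega>\<close>, where the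
  parallelogram argument applies.\<close>

definition B :: "int set" where "B = {max 0 (\<omega>+\<alpha>+\<beta>-p)..<\<alpha>}"
definition Q :: "int set" where "Q = {\<beta>..<min \<omega> (\<alpha>+\<beta>)}"
definition missP :: int where "missP = int (card ({lo..<hi} - P))"
definition missAQ :: int where "missAQ = int (card (B - A)) + int (card (Q \<inter> Neg))"

lemma missP_nonneg: "0 \<le> missP" and missAQ_nonneg: "0 \<le> missAQ" by (auto simp: missP_def missAQ_def)

lemma P_sub: "P \<subseteq> {lo..<hi}" using P_window by (auto simp: lo_def hi_def)
lemma fin_P: "finite P" using P_sub by (rule finite_subset) auto

section \<open>Counting defects when the sum exceeds \<open>2 * p / 3\<close>\<close>

context
  assumes excess: "2 * p < 3 * T"
begin

text \<open>Without \<open>P\<close> the sum is at most \<open>\<alpha> \<le> \<beta>\<close> and at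
  most \<open>p - \<beta>\<close>, hence at most \<open>p / 2\<close>.\<close>

lemma P_ne: "P \<noteq> {}"
proof
  assume "P = {}"
  have "A \<union> H \<subseteq> {0..<\<alpha>}" by (auto simp: A_def H_def)
  hence "card (A \<union> H) \<le> card {0..<\<alpha>}" by (intro card_mono) auto
  hence "int (card (A \<union> H)) \<le> \<alpha>" using \<alpha>_pos by simp
  thus False using T_le T_le_diff excess \<alpha>_le_\<beta> \<alpha>_pos \<open>P = {}\<close> by simp
qed

lemma L_pos: "0 < L" using P_ne P_sub by (auto simp: L_def)
lemma card_P: "int (card P) = L - missP"
proof -
  have "card ({lo..<hi} - P) = card {lo..<hi} - card P" using P_sub fin_P by (intro card_Diff_subset)
  moreover have "card P \<le> card {lo..<hi}" using P_sub by (intro card_mono) auto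
  ultimately show ?thesis using L_pos by (simp add: missP_def L_def)
qed

text \<open>Each defect lowers the upper bound \<open>\<alpha> + L\<close> of the sum by one, so a
  sum above \<open>2 * p / 3\<close> leaves room for few defects.\<close>

lemma budget: "2 * p + 3 * missP + 3 * missAQ + 1 \<le> 3 * \<alpha> + 3 * L"
proof -
  have d: "(A \<union> H) \<inter> (B - A) = {}"
  proof (rule equals0I)
    fix x assume "x \<in> (A \<union> H) \<inter> (B - A)"
    hence "x \<in> H" "x \<in> B" by auto
    thus False using H_window[of x] by (auto simp: B_def)
  qed
  have fin: "finite (A \<union> H)" "finite (B - A)" 
    by (rule finite_subset[of _ "{0..<\<alpha>}"]; auto simp: A_def H_def B_def)+
  have "int (card (A \<union> H)) + int (card (B - A)) = int (card ((A \<union> H) \<union> (B - A)))"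
    using card_Un_disjoint[OF fin d] by simp
  also have "\<dots> \<le> int (card {0..<\<alpha>})"
    by (intro of_nat_mono card_mono) (auto simp: A_def H_def B_def)
  finally have 1: "int (card (A \<union> H)) \<le> \<alpha> - int (card (B - A))" using \<alpha>_pos by simp
  have "int (card (Q \<inter> Neg)) \<le> int (card Neg)"
    by (intro of_nat_mono card_mono finite_subset[of Neg "{\<beta>..<\<alpha>+\<beta>}"]) (auto simp: Neg_def)
  with 1 have "T \<le> \<alpha> + L - missP - missAQ" using T_le card_P unfolding missAQ_def by linarith
  thus ?thesis using excess by linarith
qed

lemma o_nonneg: "0 \<le> p - \<alpha> - \<beta> - L" and L_le: "L \<le> \<alpha> + \<beta>"
  by (auto simp: L_def lo_def hi_def)

text \<open>Consequences of the budget tailored to later uses: \<open>size2\<close> makes room for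
  doubling the smallest distance, \<open>size3\<close> for a third point beside a close pair,
  \<open>sizeb\<close> for pairs of \<open>P\<close> at distances up to
  \<open>\<beta>\<close>.\<close>

lemma sizes:
  shows size2: "2 * \<beta> + 6 * missP + 6 * missAQ + 3 \<le> L + 2 * \<alpha>"
    and size3: "3 * \<beta> + 3 * missAQ + 2 * missP + 2 \<le> L + 3 * \<alpha>"
    and sizeb: "\<beta> + 3 * missP + 3 * missAQ + 1 \<le> L"
proof -
  obtain k where k: "p = 2 * k + 1" using p_odd by (auto elim: oddE)
  show "2 * \<beta> + 6 * missP + 6 * missAQ + 3 \<le> L + 2 * \<alpha>"
    "3 * \<beta> + 3 * missAQ + 2 * missP + 2 \<le> L + 3 * \<alpha>" "\<beta> + 3 * missP + 3 * missAQ + 1 \<le> L"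
  proof -
    have "L < p - \<alpha> - \<beta> \<or> L = p - \<alpha> - \<beta>" using o_nonneg by linarith
    thus "2 * \<beta> + 6 * missP + 6 * missAQ + 3 \<le> L + 2 * \<alpha>"
    proof
      \<comment> \<open>In this case the estimate is short by one. Since \<open>p\<close> is odd,
        \<open>p \<le> 2 * (\<alpha> + \<beta>)\<close> is strict, which supplies it.\<close>
      assume "L = p - \<alpha> - \<beta>"
      moreover from this have "k + 1 \<le> \<alpha> + \<beta>" using L_le k by linarith
      ultimately show ?thesis using budget \<alpha>_le_\<beta> k by linarith
    qed (use budget L_le \<alpha>_le_\<beta> in linarith)
    show "3 * \<beta> + 3 * missAQ + 2 * missP + 2 \<le> L + 3 * \<alpha>" "\<beta> + 3 * missP + 3 * missAQ + 1 \<le> L"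
      using budget o_nonneg L_le missP_nonneg missAQ_nonneg \<alpha>_le_\<beta> by linarith+
  qed
qed

text \<open>Pigeonhole: a missing place of \<open>{lo..<hi}\<close> spoils at most one translate per
  element of \<open>S\<close>, and there are \<open>L - M\<close> translates.\<close>

lemma P_pattern:
  assumes "finite S" "\<And>c. c \<in> S \<Longrightarrow> 0 \<le> c \<and> c \<le> M" "int (card S) * missP < L - M"
  shows "\<exists>q. \<forall>c\<in>S. q + c \<in> P"
proof (rule ccontr)
  assume "\<not> ?thesis"
  hence no: "\<exists>c\<in>S. q + c \<notin> P" for q by blast
  have sub: "{lo..<hi - M} \<subseteq> (\<Union>c\<in>S. (\<lambda>x. x - c) ` ({lo..<hi} - P))"
  proof
    fix q assume q: "q \<in> {lo..<hi - M}"
    obtain c where c: "c \<in> S" "q + c \<notin> P" using no by blast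
    hence "q + c \<in> {lo..<hi} - P" using q assms(2)[OF c(1)] by auto
    hence "q \<in> (\<lambda>x. x - c) ` ({lo..<hi} - P)" by (intro image_eqI[of _ _ "q + c"]) auto
    thus "q \<in> (\<Union>c\<in>S. (\<lambda>x. x - c) ` ({lo..<hi} - P))" using c by blast
  qed
  have "card {lo..<hi - M} \<le> card (\<Union>c\<in>S. (\<lambda>x. x - c) ` ({lo..<hi} - P))"
    using sub assms(1) by (intro card_mono) auto
  also have "\<dots> \<le> (\<Sum>c\<in>S. card ((\<lambda>x. x - c) ` ({lo..<hi} - P)))"
    using assms(1) by (rule card_UN_le)
  also have "\<dots> \<le> (\<Sum>c\<in>S. card ({lo..<hi} - P))" by (intro sum_mono card_image_le) auto
  finally have "card {lo..<hi - M} \<le> card S * card ({lo..<hi} - P)" by simp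
  hence "int (card {lo..<hi - M}) \<le> int (card S) * missP" unfolding missP_def of_nat_mult[symmetric] by (rule of_nat_mono)
  moreover have "0 \<le> int (card S) * missP" using missP_nonneg by simp
  ultimately show False using assms(3) by (simp add: L_def split: if_splits)
qed

lemma P_hit:
  assumes "lo \<le> a" "b < hi" "missP \<le> b - a"
  obtains q where "q \<in> P" "a \<le> q" "q \<le> b"
proof (rule ccontr)
  assume "\<not> thesis"
  hence "{a..b} \<subseteq> {lo..<hi} - P" using that assms by fastforce
  hence "int (card {a..b}) \<le> missP" unfolding missP_def by (intro of_nat_mono card_mono) auto
  thus False using assms missP_nonneg by simp
qed

text \<open>The candidates for \<open>x1\<close> form an interval \<open>R\<close> with more than
  \<open>missAQ\<close> elements, and each failing candidate uses up one defect of \<open>B\<close>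
  or \<open>Q\<close>.\<close>

lemma straddle:
  assumes "\<beta> - \<alpha> + 1 + missAQ \<le> c" "c \<le> L - 1 - missAQ"
  obtains x1 x where "x1 \<in> A" "x \<in> Q - Neg" "x - x1 = c"
proof (rule ccontr)
  assume "\<not> thesis"
  hence no: "\<And>x1. x1 \<in> A \<Longrightarrow> x1 + c \<in> Q \<Longrightarrow> x1 + c \<in> Neg" using that by fastforce
  define R where "R = {max (max 0 (\<omega>+\<alpha>+\<beta>-p)) (\<beta> - c)..<min \<alpha> (min \<omega> (\<alpha>+\<beta>) - c)}"
  have "R \<subseteq> (B - A) \<union> (\<lambda>x. x - c) ` (Q \<inter> Neg)"
  proof
    fix x assume x: "x \<in> R"
    hence "x \<in> B" "x + c \<in> Q" by (auto simp: R_def B_def Q_def)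
    thus "x \<in> (B - A) \<union> (\<lambda>x. x - c) ` (Q \<inter> Neg)"
      using no[of x] by (cases "x \<in> A") (auto intro!: image_eqI[of _ _ "x + c"])
  qed
  hence "card R \<le> card ((B - A) \<union> (\<lambda>x. x - c) ` (Q \<inter> Neg))"
    by (intro card_mono) (auto simp: B_def Q_def)
  also have "\<dots> \<le> card (B - A) + card ((\<lambda>x. x - c) ` (Q \<inter> Neg))" by (rule card_Un_le)
  also have "card ((\<lambda>x. x - c) ` (Q \<inter> Neg)) \<le> card (Q \<inter> Neg)"
    by (intro card_image_le) (auto simp: Q_def)
  finally have "int (card R) \<le> missAQ" by (simp add: missAQ_def)
  moreover have "0 \<le> missAQ" by (rule missAQ_nonneg)
  moreover have "missAQ < int (card R)"
  proof -
    have "L \<le> p - \<alpha> - \<beta>" "L \<le> p - \<omega>" "L \<le> \<omega>" by (auto simp: L_def lo_def hi_def)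
    hence "max (max 0 (\<omega>+\<alpha>+\<beta>-p)) (\<beta> - c) + missAQ < min \<alpha> (min \<omega> (\<alpha>+\<beta>) - c)"
      using assms sizeb missP_nonneg missAQ_nonneg L_le \<alpha>_le_\<beta> by (auto simp: max_def min_def)
    moreover have "int (card {a..<b}) = max 0 (b - a)" for a b :: int by simp
    ultimately show ?thesis using missAQ_nonneg by (simp only: R_def less_max_iff_disj) linarith
  qed
  ultimately show False by simp
qed

text \<open>
  The two possible index differences for distance \<open>c\<close> differ by \<open>p\<close>, and the parallelogram
  argument excludes the one that is realised by a pair from \<open>A\<close> and \<open>Q - Neg\<close>.
\<close>

lemma unique_diff:
  assumes c: "\<beta> - \<alpha> + 1 + missAQ \<le> c" "c \<le> L - 1 - missAQ"
    and P: "q \<in> P" "q + c \<in> P" "q' \<in> P" "q' + c \<in> P"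
  shows "idx (q + c) - idx q = idx (q' + c) - idx q'"
proof -
  obtain x1 x where x: "x1 \<in> A" "x \<in> Q - Neg" "x - x1 = c" using straddle[OF c] by blast
  have xs: "x \<in> {\<beta>..<\<alpha>+\<beta>}" "x < \<omega>" "x \<notin> Neg" using x by (auto simp: Q_def)
  have n: "idx x - idx x1 \<noteq> idx (q + c) - idx q" "idx x - idx x1 \<noteq> idx (q' + c) - idx q'"
    using parallelogram[OF x(1) xs P(1,2)] parallelogram[OF x(1) xs P(3,4)] x(3) by auto
  have "p dvd idx (q + c) - idx q - \<delta> * c" "p dvd idx (q' + c) - idx q' - \<delta> * c" "p dvd idx x - idx x1 - \<delta> * c"
    using idx_cong[of "q+c" q] idx_cong[of "q'+c" q'] idx_cong[of x x1] x(3) by auto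
  then obtain a b d where abd: "idx (q + c) - idx q - \<delta> * c = p * a" "idx (q' + c) - idx q' - \<delta> * c = p * b"
    "idx x - idx x1 - \<delta> * c = p * d" by (auto elim!: dvdE)
  have ne: "a \<noteq> d" "b \<noteq> d" using n abd by auto
  have "p * (a - d) < p * 2" "p * (d - a) < p * 2" "p * (b - d) < p * 2" "p * (d - b) < p * 2"
    "p * (a - b) < p * 2" "p * (b - a) < p * 2"
    using abd idx_range[of "q+c"] idx_range[of q] idx_range[of "q'+c"] idx_range[of q'] idx_range[of x] idx_range[of x1]
    by (simp_all add: algebra_simps)
  hence "a - d < 2" "d - a < 2" "b - d < 2" "d - b < 2" "a - b < 2" "b - a < 2"
    using p_ge by (simp_all only: mult_less_cancel_left_pos)
  hence "a = b" using ne by linarith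
  thus ?thesis using abd by simp
qed

section \<open>The index as an affine function on \<open>P\<close>\<close>

text \<open>Meaningful for distances that are covered by \<open>unique_diff\<close> and occur in
  \<open>P\<close>.\<close>

definition d :: "int \<Rightarrow> int" where
  "d c = (THE v. \<exists>q. q \<in> P \<and> q + c \<in> P \<and> v = idx (q + c) - idx q)"

lemma d_eq:
  assumes "\<beta> - \<alpha> + 1 + missAQ \<le> c" "c \<le> L - 1 - missAQ" "q \<in> P" "q + c \<in> P"
  shows "idx (q + c) - idx q = d c"
  unfolding d_def using assms unique_diff[OF assms(1,2)] by (intro the_equality[symmetric]) blast+

text \<open>Take two neighbours in \<open>P\<close> whose translates by \<open>c + 1\<close> are in
  \<open>P\<close> too: both sides are the index difference of the upper two points.\<close>

lemma d_second_difference: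
  assumes c: "\<beta> - \<alpha> + 1 + missAQ \<le> c" "c + 2 \<le> L - 1 - 4 * missP - missAQ"
  shows "d (c + 2) - d (c + 1) = d (c + 1) - d c"
proof -
  have "card {0, 1, c + 1, c + 2} \<le> 4" by (simp add: card_insert_if)
  hence "int (card {0, 1, c + 1, c + 2}) * missP \<le> 4 * missP"
    using missP_nonneg by (intro mult_right_mono) auto
  hence "int (card {0, 1, c + 1, c + 2}) * missP < L - (c + 2)"
    using c missAQ_nonneg by linarith
  hence "\<exists>q. \<forall>x\<in>{0, 1, c + 1, c + 2}. q + x \<in> P"
    using c missAQ_nonneg \<alpha>_le_\<beta> by (intro P_pattern[of _ "c + 2"]) auto
  then obtain q where q: "\<And>x. x \<in> {0, 1, c + 1, c + 2} \<Longrightarrow> q + x \<in> P" by blast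
  have P: "q \<in> P" "q + 1 \<in> P" "q + (c + 1) \<in> P" "q + (c + 2) \<in> P" using q[of 0] q by auto
  have cs: "c \<le> L - 1 - missAQ" "c + 1 \<le> L - 1 - missAQ" "c + 2 \<le> L - 1 - missAQ" using c missP_nonneg by linarith+
  have "idx (q + (c + 1)) - idx q = d (c + 1)" "idx (q + (c + 2)) - idx q = d (c + 2)"
    using c cs P by (intro d_eq; simp)+
  moreover have "idx (q + 1 + c) - idx (q + 1) = d c" "idx (q + 1 + (c + 1)) - idx (q + 1) = d (c + 1)"
  proof -
    have "q + 1 + c \<in> P" "q + 1 + (c + 1) \<in> P" using P(3,4) by (simp_all add: add_ac)
    thus "idx (q + 1 + c) - idx (q + 1) = d c" "idx (q + 1 + (c + 1)) - idx (q + 1) = d (c + 1)"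
      using d_eq[of c "q + 1"] d_eq[of "c + 1" "q + 1"] c(1) cs P(2) by simp_all
  qed
  ultimately show ?thesis by (simp add: add_ac)
qed

text \<open>Vanishing second differences only make \<open>d\<close> affine; three equally spaced
  points of \<open>P\<close> remove the constant term.\<close>

lemma d_double:
  assumes c: "c = \<beta> - \<alpha> + 1 + missAQ"
  shows "d (2 * c) = 2 * d c"
proof -
  have "card {0, c, 2 * c} \<le> 3" by (simp add: card_insert_if)
  hence "int (card {0, c, 2 * c}) * missP \<le> 3 * missP"
    using missP_nonneg by (intro mult_right_mono) auto
  moreover have c0: "0 \<le> c" "2 * c \<le> L - 1 - 4 * missP - missAQ" using c \<alpha>_le_\<beta> missAQ_nonneg missP_nonneg size2 by linarith+
  ultimately have "int (card {0, c, 2 * c}) * missP < L - 2 * c" using missP_nonneg missAQ_nonneg by linarith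
  hence "\<exists>q. \<forall>x\<in>{0, c, 2 * c}. q + x \<in> P"
    using c0 by (intro P_pattern[of _ "2 * c"]) auto
  then obtain q where q: "\<And>x. x \<in> {0, c, 2 * c} \<Longrightarrow> q + x \<in> P" by blast
  have P: "q \<in> P" "q + c \<in> P" "q + 2 * c \<in> P" using q[of 0] q by auto
  have "idx (q + c) - idx q = d c" "idx (q + 2 * c) - idx q = d (2 * c)" "idx (q + c + c) - idx (q + c) = d c"
    using c c0 P missP_nonneg by (intro d_eq; simp add: add.assoc mult_2[symmetric])+
  thus ?thesis by (simp add: add.assoc mult_2[symmetric])
qed

lemma d_linear_ex:
  "\<exists>D. \<forall>c. \<beta> - \<alpha> + 1 + missAQ \<le> c \<longrightarrow> c \<le> L - 1 - 4 * missP - missAQ \<longrightarrow> d c = D * c"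
proof -
  define c0 where "c0 = \<beta> - \<alpha> + 1 + missAQ"
  define D where "D = d (c0 + 1) - d c0"
  have c0: "1 \<le> c0" "2 * c0 \<le> L - 1 - 4 * missP - missAQ"
    using \<alpha>_le_\<beta> missAQ_nonneg missP_nonneg size2 by (auto simp: c0_def)
  have step: "c0 + int k + 1 \<le> L - 1 - 4 * missP - missAQ \<Longrightarrow> d (c0 + int k + 1) - d (c0 + int k) = D" for k
  proof (induction k)
    case (Suc k)
    have "d (c0 + int k + 2) - d (c0 + int k + 1) = d (c0 + int k + 1) - d (c0 + int k)"
      using Suc.prems by (intro d_second_difference) (auto simp: c0_def)
    thus ?case using Suc by (simp add: add_ac)
  qed (simp add: D_def)
  have lin: "c0 + int k \<le> L - 1 - 4 * missP - missAQ \<Longrightarrow> d (c0 + int k) = d c0 + D * int k" for k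
  proof (induction k)
    case (Suc k)
    thus ?case using step[of k] by (simp add: algebra_simps)
  qed simp
  have "d (c0 + int (nat c0)) = d c0 + D * int (nat c0)" using c0 by (intro lin) auto
  moreover have "int (nat c0) = c0" using c0 by simp
  moreover have "d (2 * c0) = 2 * d c0" by (rule d_double) (rule c0_def)
  ultimately have z: "d c0 = D * c0" by (simp only: mult_2)
  show ?thesis
  proof (intro exI[of _ D] allI impI)
    fix c assume c: "\<beta> - \<alpha> + 1 + missAQ \<le> c" "c \<le> L - 1 - 4 * missP - missAQ"
    define k where "k = nat (c - c0)"
    have k: "c = c0 + int k" using c by (simp add: k_def c0_def)
    have "d (c0 + int k) = d c0 + D * int k" using c by (intro lin) (simp add: k)
    thus "d c = D * c" using z by (simp only: k distrib_left)
  qed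
qed

text \<open>Distances from \<open>c0\<close> to \<open>c1\<close> are covered by \<open>d\<close>. A
  closer pair is compared with a third point farther away, a wider pair is split at an intermediate
  point.\<close>

lemma idx_affine_ex: "\<exists>D. \<forall>u\<in>P. \<forall>w\<in>P. idx w - idx u = D * (w - u)"
proof -
  obtain D where D: "\<And>c. \<beta> - \<alpha> + 1 + missAQ \<le> c \<Longrightarrow> c \<le> L - 1 - 4 * missP - missAQ \<Longrightarrow> d c = D * c"
    using d_linear_ex by blast
  define c0 c1 where "c0 = \<beta> - \<alpha> + 1 + missAQ" and "c1 = L - 1 - 4 * missP - missAQ"
  have c01: "1 \<le> c0" "2 * c0 + missP \<le> c1 + 1"
    using \<alpha>_le_\<beta> missAQ_nonneg missP_nonneg size2 by (auto simp: c0_def c1_def)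
  have good: "idx w - idx u = D * (w - u)" if "u \<in> P" "w \<in> P" "c0 \<le> w - u" "w - u \<le> c1" for u w
    using D[of "w - u"] d_eq[of "w - u" u] that missP_nonneg by (simp add: c0_def c1_def)
  have main: "idx w - idx u = D * (w - u)" if "u \<in> P" "w \<in> P" "u < w" for u w
    using that
  proof (induction "nat (w - u)" arbitrary: u w rule: less_induct)
    case less
    have r: "lo \<le> u" "w < hi" using less.prems P_sub by auto
    consider "w - u < c0" | "c0 \<le> w - u" "w - u \<le> c1" | "c1 < w - u" by linarith
    thus ?case
    proof cases
      case 1
      \<comment> \<open>\<open>size3\<close> leaves room for the third point on at least one side of
        the pair.\<close>
      have "missP \<le> hi - 1 - (w + c0) \<or> missP \<le> (u - c0) - lo"
        using size3 1 by (auto simp: c0_def L_def)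
      thus ?thesis
      proof
        assume a: "missP \<le> hi - 1 - (w + c0)"
        obtain z where z: "z \<in> P" "w + c0 \<le> z" "z \<le> w + c0 + missP"
          using a r less.prems c01 by (auto intro: P_hit[of "w + c0" "w + c0 + missP"])
        have "idx z - idx u = D * (z - u)" "idx z - idx w = D * (z - w)"
          using z 1 c01 less.prems missP_nonneg by (intro good; simp)+
        thus ?thesis by (simp add: algebra_simps)
      next
        assume a: "missP \<le> (u - c0) - lo"
        obtain z where z: "z \<in> P" "u - c0 - missP \<le> z" "z \<le> u - c0"
          using a r less.prems c01 by (auto intro: P_hit[of "u - c0 - missP" "u - c0"])
        have "idx u - idx z = D * (u - z)" "idx w - idx z = D * (w - z)"
          using z 1 c01 less.prems missP_nonneg by (intro good; simp)+
        thus ?thesis by (simp add: algebra_simps)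
      qed
    next
      case 2
      thus ?thesis using good less.prems by blast
    next
      case 3
      obtain z where z: "z \<in> P" "u + c0 \<le> z" "z \<le> u + c0 + missP"
        using 3 r less.prems c01 by (auto intro: P_hit[of "u + c0" "u + c0 + missP"])
      have "idx z - idx u = D * (z - u)"
        using z 3 c01 less.prems by (intro good) auto
      moreover have "idx w - idx z = D * (w - z)"
        using z 3 c01 less.prems by (intro less.hyps) auto
      ultimately show ?thesis by (simp add: algebra_simps)
    qed
  qed
  show ?thesis
  proof (intro exI[of _ D] ballI)
    fix u w assume "u \<in> P" "w \<in> P"
    thus "idx w - idx u = D * (w - u)"
      using main[of u w] main[of w u] by (cases u w rule: linorder_cases) (auto simp: algebra_simps)
  qed
qed

definition D :: int where "D = (SOME D. \<forall>u\<in>P. \<forall>w\<in>P. idx w - idx u = D * (w - u))"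

lemma D: "u \<in> P \<Longrightarrow> w \<in> P \<Longrightarrow> idx w - idx u = D * (w - u)"
  using someI_ex[OF idx_affine_ex] unfolding D_def by blast

section \<open>Bounding the slope\<close>

definition a where "a = Min P"
definition b where "b = Max P"
lemma a: "a \<in> P" and b: "b \<in> P" using P_ne fin_P by (auto simp: a_def b_def)

lemma ab: "L - 1 - missP \<le> b - a"
proof -
  have "P \<subseteq> {a..b}" using fin_P by (auto simp: a_def b_def)
  hence "int (card P) \<le> int (card {a..b})" by (intro of_nat_mono card_mono) auto
  moreover have "a \<le> b" using a fin_P by (simp add: b_def)
  ultimately show ?thesis using card_P by simp
qed

lemma b_ge: "hi - 1 - missP \<le> b"
proof -
  have "a \<in> P" by (rule a)
  hence "lo \<le> a" using P_sub by auto
  thus ?thesis using ab by (simp add: L_def)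
qed

lemma P_pair:
  assumes "0 \<le> c" "2 * missP < L - c"
  obtains q where "q \<in> P" "q + c \<in> P"
proof -
  have "card {0, c} \<le> 2" by (simp add: card_insert_if)
  hence "int (card {0, c}) * missP \<le> 2 * missP" using missP_nonneg by (intro mult_right_mono) auto
  hence "int (card {0, c}) * missP < L - c" using assms by linarith
  hence "\<exists>q. \<forall>x\<in>{0, c}. q + x \<in> P"
    using assms by (intro P_pattern[of _ c]) auto
  thus ?thesis using that by auto
qed

lemma D_cong: "p dvd D - \<delta>"
proof -
  obtain q where "q \<in> P" "q + 1 \<in> P" using P_pair[of 1] sizeb missP_nonneg missAQ_nonneg \<alpha>_pos \<alpha>_le_\<beta> by auto
  thus ?thesis using D[of q "q + 1"] idx_cong[of "q + 1" q] by simp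
qed

text \<open>The indices of \<open>P\<close> spread over less than \<open>p\<close>. A slope beyond 2
  then forces \<open>\<alpha> = \<beta>\<close>, \<open>3 * \<beta> = p - 1\<close> and slope 3 or
  -3, which the congruence for \<open>\<delta> * s * t\<close> excludes.\<close>

lemma D_bound: "\<bar>D\<bar> \<le> 2"
proof (rule ccontr)
  assume n: "\<not> \<bar>D\<bar> \<le> 2"
  have ba: "0 \<le> b - a" using ab sizeb missP_nonneg missAQ_nonneg \<alpha>_pos \<alpha>_le_\<beta> by linarith
  have "\<bar>D\<bar> * (b - a) = \<bar>idx b - idx a\<bar>" using D[OF a b] ba by (simp add: abs_mult)
  also have "\<dots> < p" using idx_range[of a] idx_range[of b] by linarith
  finally have lt: "\<bar>D\<bar> * (b - a) < p" .
  have "3 * (b - a) \<le> \<bar>D\<bar> * (b - a)" using n ba by (intro mult_right_mono) auto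
  hence "3 * b - 3 * a < p" using lt by (simp add: right_diff_distrib)
  hence al: "\<beta> = \<alpha>" "3 * \<beta> = p - 1" "3 * b - 3 * a = p - 1"
    using ab budget o_nonneg missP_nonneg missAQ_nonneg \<alpha>_le_\<beta> by linarith+
  have "\<bar>D\<bar> < 4"
  proof (rule ccontr)
    assume "\<not> \<bar>D\<bar> < 4"
    hence "4 * (b - a) \<le> \<bar>D\<bar> * (b - a)" using ba by (intro mult_right_mono) auto
    hence "4 * b - 4 * a < p" using lt by (simp add: right_diff_distrib)
    thus False using al p_ge by linarith
  qed
  hence "D = 3 \<or> D = -3" using n by linarith
  then obtain \<sigma> :: int where \<sigma>: "D = 3 * \<sigma>" "\<sigma> \<in> {1, -1}"
    by (metis insertI1 insertI2 mult.right_neutral mult_minus_right)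
  \<comment> \<open>Now \<open>s * t\<close> is the square of \<open>\<beta>\<close>, so 9 times it
    is 1 modulo \<open>p\<close>, while \<open>\<delta> * s * t\<close> is 1 or -1 modulo
    \<open>p\<close>.\<close>
  define S where "S = s * t"
  have "S = \<beta> * \<beta>" using al by (auto simp: S_def \<alpha>_def \<beta>_def min_def max_def split: if_splits)
  hence "9 * S = (3 * \<beta>) * (3 * \<beta>)" by simp
  hence "9 * S = (p - 1) * (p - 1)" unfolding al(2) .
  hence "9 * S - 1 = p * (p - 2)" by (simp add: algebra_simps)
  hence S: "p dvd 9 * S - 1" by simp
  obtain \<epsilon> :: int where \<epsilon>: "p dvd \<delta> * S - \<epsilon>" "\<epsilon> \<in> {1, -1}"
    using dvd_\<delta> that[of 1] that[of "-1"] by (auto simp: S_def mult.assoc)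
  have "p dvd (D - \<delta>) * S + (\<delta> * S - \<epsilon>)" using D_cong \<epsilon> by (intro dvd_add dvd_mult2) auto
  hence "p dvd D * S - \<epsilon>" by (simp add: algebra_simps)
  hence "p dvd 3 * (D * S - \<epsilon>)" by (rule dvd_mult)
  also have "3 * (D * S - \<epsilon>) = \<sigma> * (9 * S - 1) + (\<sigma> - 3 * \<epsilon>)" by (simp add: \<sigma> algebra_simps)
  finally have "p dvd \<sigma> - 3 * \<epsilon>" using S by (subst (asm) dvd_add_right_iff) auto
  \<comment> \<open>The possible values are 2, -2, 4 and -4.\<close>
  moreover have "\<sigma> - 3 * \<epsilon> dvd 4" using \<sigma> \<epsilon> by auto
  ultimately have "p dvd 4" by (rule dvd_trans)
  hence "p \<le> 4" by (rule zdvd_imp_le) simp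
  hence "p = 3" using p_ge p_odd by presburger
  thus False using \<open>p dvd 4\<close> by simp
qed

section \<open>Monotone coordinates and the contradiction\<close>

text \<open>Used for \<open>\<eta>\<close> and \<open>\<zeta>\<close>, which vary by less than
  \<open>N / 3\<close> on \<open>P\<close>. Congruent differences then agree as integers, so the
  step \<open>Y\<close> is constant and its multiples up to \<open>\<beta>\<close> are again
  differences on \<open>P\<close>.\<close>

lemma slope:
  fixes h :: "int \<Rightarrow> int"
  assumes h: "\<And>u w. u \<in> P \<Longrightarrow> w \<in> P \<Longrightarrow> \<bar>h w - h u\<bar> \<le> r" and r: "3 * r < N"
    and cong: "\<And>u w. N dvd h w - h u - \<kappa> * (idx w - idx u)"
  shows "\<exists>Y. N dvd Y - \<kappa> * D \<and> (\<forall>u. u \<in> P \<longrightarrow> u + 1 \<in> P \<longrightarrow> h (u + 1) - h u = Y) \<and> \<bar>\<beta> * Y\<bar> \<le> r"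
proof -
  have c1: "N dvd h w - h u - \<kappa> * D * (w - u)" if "u \<in> P" "w \<in> P" for u w
    using cong[of w u] D[OF that] by (simp add: mult.assoc)
  have small: "x = 0" if "N dvd x" "\<bar>x\<bar> < N" for x :: int
    using that dvd_imp_le_int[of x N] N_pos by auto
  obtain q where q: "q \<in> P" "q + 1 \<in> P"
    using P_pair[of 1] sizeb missP_nonneg missAQ_nonneg \<alpha>_pos \<alpha>_le_\<beta> by auto
  define Y where "Y = h (q + 1) - h q"
  have Y: "N dvd Y - \<kappa> * D" using c1[OF q] by (simp add: Y_def)
  have Yr: "\<bar>Y\<bar> \<le> r" using h[OF q] by (simp add: Y_def)
  have eq: "h (u + 1) - h u = Y" if "u \<in> P" "u + 1 \<in> P" for u
  proof -
    have "N dvd h (u + 1) - h u - \<kappa> * D" using c1[OF that] by simp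
    hence "N dvd (h (u + 1) - h u - \<kappa> * D) - (Y - \<kappa> * D)" using Y by (rule dvd_diff)
    hence "N dvd h (u + 1) - h u - Y" by (simp add: algebra_simps)
    moreover have "\<bar>h (u + 1) - h u - Y\<bar> < N" using h[OF that] Yr r by linarith
    ultimately show ?thesis using small[of "h (u + 1) - h u - Y"] by simp
  qed
  have "int k \<le> \<beta> \<Longrightarrow> \<bar>int k * Y\<bar> \<le> r" for k
  proof (induction k)
    case 0
    thus ?case using Yr by simp
  next
    case (Suc k)
    have "2 * missP < L - int (Suc k)" using Suc.prems sizeb missP_nonneg missAQ_nonneg by linarith
    then obtain q' where q': "q' \<in> P" "q' + int (Suc k) \<in> P" using P_pair[of "int (Suc k)"] by auto
    define e where "e = h (q' + int (Suc k)) - h q'"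
    have er: "\<bar>e\<bar> \<le> r" using h[OF q'] by (simp only: e_def)
    have "N dvd e - \<kappa> * D * int (Suc k)" using c1[OF q'] by (simp add: e_def)
    moreover have "N dvd int (Suc k) * (Y - \<kappa> * D)" using Y by (rule dvd_mult)
    ultimately have "N dvd (e - \<kappa> * D * int (Suc k)) - int (Suc k) * (Y - \<kappa> * D)" by (rule dvd_diff)
    hence "N dvd e - int (Suc k) * Y" by (simp add: algebra_simps)
    \<comment> \<open>The three parts \<open>e\<close>, the previous multiple and one more step are
      each at most \<open>r < N / 3\<close> in size.\<close>
    moreover have "\<bar>e - int (Suc k) * Y\<bar> < N"
    proof -
      have "int (Suc k) * Y = int k * Y + Y" by (simp add: algebra_simps)
      moreover have "\<bar>int k * Y\<bar> \<le> r" using Suc by simp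
      ultimately show ?thesis using er Yr r by linarith
    qed
    ultimately have "int (Suc k) * Y = e" using small[of "e - int (Suc k) * Y"] by simp
    thus ?case using er by simp
  qed
  from this[of "nat \<beta>"] have "\<bar>\<beta> * Y\<bar> \<le> r" using \<alpha>_pos \<alpha>_le_\<beta> by simp
  with Y eq show ?thesis by blast
qed

lemma A_hit: "\<exists>x1\<in>A. \<alpha> - 1 - missAQ \<le> x1"
proof (rule ccontr)
  assume no: "\<not> ?thesis"
  have "L \<le> p - \<omega>" "L \<le> \<alpha> + \<beta>" by (auto simp: L_def lo_def hi_def)
  hence "{\<alpha> - 1 - missAQ..<\<alpha>} \<subseteq> B" using sizeb missP_nonneg missAQ_nonneg by (auto simp: B_def)
  hence "{\<alpha> - 1 - missAQ..<\<alpha>} \<subseteq> B - A" using no by auto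
  hence "card {\<alpha> - 1 - missAQ..<\<alpha>} \<le> card (B - A)" by (intro card_mono) (auto simp: B_def)
  thus False using missAQ_nonneg by (simp add: missAQ_def)
qed

lemma Q_hit: "\<exists>x\<in>Q - Neg. x \<le> \<beta> + missAQ"
proof (rule ccontr)
  assume no: "\<not> ?thesis"
  have "L \<le> \<omega>" "L \<le> \<alpha> + \<beta>" by (auto simp: L_def lo_def hi_def)
  hence "{\<beta>..\<beta> + missAQ} \<subseteq> Q" using sizeb missP_nonneg missAQ_nonneg by (auto simp: Q_def)
  hence "{\<beta>..\<beta> + missAQ} \<subseteq> Q \<inter> Neg" using no by fastforce
  hence "card {\<beta>..\<beta> + missAQ} \<le> card (Q \<inter> Neg)" by (intro card_mono) (auto simp: Q_def)
  thus False using missAQ_nonneg by (simp add: missAQ_def)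
qed

text \<open>
  Between \<open>x1 \<in> A\<close> and \<open>x \<in> Q - Neg\<close> the index must differ from the affine function \<open>M\<close> by a
  multiple of \<open>p\<close>, so \<open>M\<close> wraps there; as \<open>\<bar>D\<bar> \<le> 2\<close>, it has no room to wrap a second time
  between \<open>P\<close> and the next copy of \<open>x1\<close>.
\<close>

lemma junction: "\<exists>x1\<in>A. \<exists>x2\<in>P. idx x1 - idx x2 = D * (p + x1 - x2)"
proof -
  obtain x1 where x1: "x1 \<in> A" "\<alpha> - 1 - missAQ \<le> x1" using A_hit by blast
  obtain x where x: "x \<in> Q" "x \<notin> Neg" "x \<le> \<beta> + missAQ" using Q_hit by blast
  have xs: "x \<in> {\<beta>..<\<alpha>+\<beta>}" "x < \<omega>" using x by (auto simp: Q_def)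
  have x1r: "0 \<le> x1" "x1 < \<alpha>" using x1 by (auto simp: A_def)
  have "2 * missP < L - (x - x1)" "0 \<le> x - x1"
    using xs x x1 x1r size2 missP_nonneg missAQ_nonneg \<alpha>_le_\<beta> by auto
  then obtain q where q: "q \<in> P" "q + (x - x1) \<in> P" using P_pair by blast
  have ne: "idx x - idx x1 \<noteq> D * (x - x1)"
    using parallelogram[OF x1(1) xs x(2) q] D[OF q] by simp
  \<comment> \<open>The affine function of \<open>P\<close> continued to all integers;
    \<open>idx\<close> is its residue modulo \<open>p\<close>.\<close>
  define M where "M X = idx a + D * (X - a)" for X
  have Mdiff: "M X = M Z + D * (X - Z)" for X Z by (simp add: M_def algebra_simps)
  have Mab: "M a = idx a" "M b = idx b" using D[OF a b] by (simp_all add: M_def)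
  have idxM: "idx X = M X - p * (M X div p)" for X
  proof -
    have "p dvd idx X - idx a - \<delta> * (X - a)" by (rule idx_cong)
    moreover have "p dvd (D - \<delta>) * (X - a)" using D_cong by (rule dvd_mult2)
    ultimately have "p dvd (idx X - idx a - \<delta> * (X - a)) - (D - \<delta>) * (X - a)" by (rule dvd_diff)
    hence "p dvd idx X - M X" by (simp add: M_def algebra_simps)
    hence "idx X mod p = M X mod p" by (simp add: mod_eq_dvd_iff)
    hence "idx X = M X mod p" using idx_range[of X] by simp
    thus ?thesis by (simp add: minus_mult_div_eq_mod)
  qed
  have per: "idx (p + X) = idx X" for X
  proof -
    have "\<mu> + \<delta> * (p + X) = (\<mu> + \<delta> * X) + \<delta> * p" by (simp add: algebra_simps)
    thus ?thesis unfolding idx_def by (simp only: mod_mult_self1)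
  qed
  \<comment> \<open>The numbers of wraps of \<open>M\<close> at the copies of \<open>x1\<close> and
    \<open>x\<close> one period later. They differ by the parallelogram argument, and
    \<open>k1 = 0\<close> is the goal.\<close>
  define k1 k2 where "k1 = M (p + x1) div p" and "k2 = M (p + x) div p"
  have m1: "idx x1 = M (p + x1) - p * k1" and m2: "idx x = M (p + x) - p * k2"
    using idxM[of "p + x1"] idxM[of "p + x"] by (simp_all only: per k1_def k2_def)
  have M12: "M (p + x) = M (p + x1) + D * (x - x1)" using Mdiff[of "p + x" "p + x1"] by simp
  have k: "k1 \<noteq> k2" using ne m1 m2 M12 by auto
  have hi: "\<alpha> + \<beta> + L \<le> hi" by (simp add: L_def lo_def)
  \<comment> \<open>With a slope of absolute value at most 2, \<open>M\<close> moves by at most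
    \<open>p\<close> between \<open>b\<close> and \<open>p + x\<close>.\<close>
  have dist: "2 * p + 2 * x - 2 * b \<le> p"
    using x b_ge hi budget missP_nonneg missAQ_nonneg p_ge o_nonneg \<alpha>_le_\<beta> by linarith
  have xb: "0 \<le> p + x - b" using xs P_range[OF b] \<alpha>_pos \<alpha>_le_\<beta> by auto
  have ax: "a \<le> p + x1" using P_range[OF a] x1r by simp
  have xx: "0 \<le> x - x1" using x1r xs \<alpha>_le_\<beta> by auto
  have "k1 = 0"
  proof (cases "0 \<le> D")
    case True
    have "0 \<le> D * (p + x1 - a)" using True ax by simp
    hence "0 \<le> M (p + x1)" using Mdiff[of "p + x1" a] Mab idx_range[of a] by linarith
    hence k1: "0 \<le> k1" using p_ge by (simp add: k1_def pos_imp_zdiv_nonneg_iff)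
    have "0 \<le> D * (x - x1)" using True xx by simp
    hence "k1 \<le> k2" using p_ge M12 unfolding k1_def k2_def by (intro zdiv_mono1) auto
    moreover have "k2 < 2"
    proof -
      have "D * (p + x - b) \<le> 2 * (p + x - b)" using D_bound xb by (intro mult_right_mono) auto
      moreover have "2 * (p + x - b) \<le> p" using dist by (simp add: algebra_simps)
      ultimately have "p * k2 < p * 2" using Mdiff[of "p + x" b] Mab idx_range[of b] idx_range[of x] m2 by linarith
      thus ?thesis using p_ge by (simp only: mult_less_cancel_left_pos)
    qed
    ultimately show ?thesis using k k1 by linarith
  next
    case False
    have "D * (p + x1 - a) \<le> 0" using False ax by (intro mult_nonpos_nonneg) auto
    hence "p * k1 < p * 1" using Mdiff[of "p + x1" a] Mab idx_range[of a] m1 idx_range[of x1] by linarith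
    hence k1: "k1 \<le> 0" using p_ge by (simp only: mult_less_cancel_left_pos)
    have "D * (x - x1) \<le> 0" using False xx by (intro mult_nonpos_nonneg) auto
    hence "k2 \<le> k1" using p_ge M12 unfolding k1_def k2_def by (intro zdiv_mono1) auto
    moreover have "- 2 < k2"
    proof -
      have "- 2 * (p + x - b) \<le> D * (p + x - b)" using D_bound xb by (intro mult_right_mono) auto
      moreover have "- p \<le> - 2 * (p + x - b)" using dist by (simp add: algebra_simps)
      ultimately have "p * (- 2) < p * k2"
        using Mdiff[of "p + x" b] Mab idx_range[of b] idx_range[of x] m2 by linarith
      thus ?thesis using p_ge by (simp only: mult_less_cancel_left_pos)
    qed
    ultimately show ?thesis using k k1 by linarith
  qed
  hence "idx x1 - idx b = D * (p + x1 - b)" using m1 Mdiff[of "p + x1" b] Mab by simp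
  thus ?thesis using x1(1) b by blast
qed

text \<open>The steps \<open>Y\<close> and \<open>Z\<close> are nonnegative. From \<open>x2\<close>
  in \<open>P\<close> to the copy of \<open>x1\<close> in \<open>A\<close> one period later, the
  balance forces the two coordinates to gain \<open>N\<close> in total beyond these steps. So one of
  them would grow by at least \<open>N\<close>, which its range forbids.\<close>

lemma no_excess: False
proof -
  have b3: "3 * ay < N" "3 * az < N"
  proof -
    have "3 * \<beta> \<le> p" using budget o_nonneg missP_nonneg missAQ_nonneg by linarith
    hence "3 * \<beta> * U \<le> p * U" using U_pos by (intro mult_right_mono) auto
    thus "3 * ay < N" "3 * az < N" using ay_\<beta> az_\<beta> p_ge by (auto simp: N_def)
  qed
  obtain Y where Y: "N dvd Y - \<theta> * D" "\<And>u. u \<in> P \<Longrightarrow> u + 1 \<in> P \<Longrightarrow> \<eta> (u + 1) - \<eta> u = Y" "\<bar>\<beta> * Y\<bar> \<le> ay"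
    using slope[of \<eta> ay \<theta>, OF P_\<eta> b3(1) \<eta>_cong] by blast
  obtain Z where Z: "N dvd Z - \<phi> * D" "\<And>u. u \<in> P \<Longrightarrow> u + 1 \<in> P \<Longrightarrow> \<zeta> (u + 1) - \<zeta> u = Z" "\<bar>\<beta> * Z\<bar> \<le> az"
    using slope[of \<zeta> az \<phi>, OF P_\<zeta> b3(2) \<zeta>_cong] by blast
  obtain q where q: "q \<in> P" "q + 1 \<in> P"
    using P_pair[of 1] sizeb missP_nonneg missAQ_nonneg \<alpha>_pos \<alpha>_le_\<beta> by auto
  have "Y + Z = (q + 1) * U - q * U + (idx (q + 1) - idx q)"
    using P_bal[OF q(1)] P_bal[OF q(2)] Y(2)[OF q] Z(2)[OF q] by linarith
  hence YZ: "Y + Z = U + D" using D[OF q] by (simp add: algebra_simps)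
  have \<beta>: "1 \<le> \<beta>" "\<beta> < p" using \<alpha>_pos \<alpha>_le_\<beta> \<beta>_half by linarith+
  \<comment> \<open>If one step were negative, the other would be at least \<open>U - 1\<close>, and
    \<open>\<beta>\<close> times it would exceed \<open>\<beta> * U - p\<close> because
    \<open>\<beta> < p\<close>.\<close>
  have nonneg: "0 \<le> v" if "v + w = U + D" "\<bar>\<beta> * w\<bar> \<le> r" "r + p \<le> \<beta> * U" for v w r
  proof (rule ccontr)
    assume "\<not> 0 \<le> v"
    hence "U - 1 \<le> w" using that D_bound by linarith
    hence "\<beta> * (U - 1) \<le> \<beta> * w" using \<beta> by (intro mult_left_mono) auto
    thus False using that \<beta> by (simp add: right_diff_distrib)
  qed
  have Y0: "0 \<le> Y" using nonneg[of Y Z az] YZ Z(3) az_\<beta> by simp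
  have Z0: "0 \<le> Z" using nonneg[of Z Y ay] YZ Y(3) ay_\<beta> by simp
  obtain x1 x2 where x: "x1 \<in> A" "x2 \<in> P" "idx x1 - idx x2 = D * (p + x1 - x2)" using junction by blast
  define c where "c = p + x1 - x2"
  have c: "0 \<le> c" using A_range[OF x(1)] P_range[OF x(2)] by (simp add: c_def)
  have "N dvd (\<eta> x1 - \<eta> x2 - \<theta> * (idx x1 - idx x2)) - c * (Y - \<theta> * D)"
    by (rule dvd_diff[OF \<eta>_cong dvd_mult[OF Y(1)]])
  hence "N dvd \<eta> x1 - \<eta> x2 - c * Y" by (simp add: x(3) c_def[symmetric] algebra_simps)
  then obtain i where i: "\<eta> x1 - \<eta> x2 - c * Y = N * i" by (elim dvdE)
  have "N dvd (\<zeta> x1 - \<zeta> x2 - \<phi> * (idx x1 - idx x2)) - c * (Z - \<phi> * D)"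
    by (rule dvd_diff[OF \<zeta>_cong dvd_mult[OF Z(1)]])
  hence "N dvd \<zeta> x1 - \<zeta> x2 - c * Z" by (simp add: x(3) c_def[symmetric] algebra_simps)
  then obtain j where j: "\<zeta> x1 - \<zeta> x2 - c * Z = N * j" by (elim dvdE)
  have "c * Y + c * Z = c * U + c * D" using YZ by (simp only: distrib_left[symmetric])
  moreover have "x1 * U = x2 * U + c * U - N" by (simp add: c_def N_def algebra_simps)
  moreover have "idx x1 - idx x2 = c * D" using x(3) by (simp add: c_def)
  ultimately have "N * i + N * j = N"
    using i j A_bal[OF x(1)] P_bal[OF x(2)] by linarith
  hence "N * (i + j) = N * 1" by (simp add: distrib_left)
  hence "i + j = 1" using N_pos by simp
  hence "1 \<le> i \<or> 1 \<le> j" by linarith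
  thus False
  proof
    assume "1 \<le> i"
    hence "N * 1 \<le> N * i" using N_pos by (intro mult_left_mono) auto
    moreover have "0 \<le> c * Y" using c Y0 by simp
    ultimately show False using i \<eta>_range[of x1] \<eta>_range[of x2] by linarith
  next
    assume "1 \<le> j"
    hence "N * 1 \<le> N * j" using N_pos by (intro mult_left_mono) auto
    moreover have "0 \<le> c * Z" using c Z0 by simp
    ultimately show False using j \<zeta>_range[of x1] \<zeta>_range[of x2] by linarith
  qed
qed

end

lemma T_le_two_thirds: "3 * T \<le> 2 * p"
  using no_excess not_le by blast

end

section \<open>Mixed radix digits\<close>

locale mixed_radix =
  fixes p q r :: int
  assumes p_gt: "1 < p" and q_gt: "1 < q" and r_gt: "1 < r"
    and coprimes: "coprime p q" "coprime p r" "coprime q r"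
begin

definition N :: int where "N = p * q * r"
definition i1 :: int where "i1 = (SOME i. [q * r * i = 1] (mod p))"
definition i2 :: int where "i2 = (SOME i. [p * r * i = 1] (mod q))"
definition i3 :: int where "i3 = (SOME i. [p * q * i = 1] (mod r))"
definition xd :: "int \<Rightarrow> int" where "xd k = k * i1 mod p"
definition yd :: "int \<Rightarrow> int" where "yd k = k * i2 mod q"
definition zd :: "int \<Rightarrow> int" where "zd k = k * i3 mod r"
definition Gd :: "int \<Rightarrow> int" where "Gd k = (xd k * (q * r) + yd k * (p * r) + zd k * (p * q) - k) div N"
definition \<chi> :: "int \<Rightarrow> int" where
  "\<chi> k = of_bool (\<exists>x y z. 0 \<le> x \<and> x < p \<and> 0 \<le> y \<and> y < q \<and> 0 \<le> z \<and> z < r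
      \<and> k = x * (q * r) + y * (p * r) + z * (p * q))"

lemma N_pos: "0 < N" using p_gt q_gt r_gt by (simp add: N_def)

lemma i1: "[q * r * i1 = 1] (mod p)" and i2: "[p * r * i2 = 1] (mod q)" and i3: "[p * q * i3 = 1] (mod r)"
proof -
  have "coprime (q * r) p" "coprime (p * r) q" "coprime (p * q) r"
    using coprimes by (simp_all add: coprime_commute)
  note ex = this[THEN cong_solve_coprime_int]
  show "[q * r * i1 = 1] (mod p)" unfolding i1_def by (rule someI_ex[OF ex(1)])
  show "[p * r * i2 = 1] (mod q)" unfolding i2_def by (rule someI_ex[OF ex(2)])
  show "[p * q * i3 = 1] (mod r)" unfolding i3_def by (rule someI_ex[OF ex(3)])
qed

lemma xd_range: "0 \<le> xd k" "xd k < p" and yd_range: "0 \<le> yd k" "yd k < q" and zd_range: "0 \<le> zd k" "zd k < r"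
  using p_gt q_gt r_gt by (simp_all add: xd_def yd_def zd_def)

lemma xd_cong: "[xd k * (q * r) = k] (mod p)"
  and yd_cong: "[yd k * (p * r) = k] (mod q)" and zd_cong: "[zd k * (p * q) = k] (mod r)"
proof -
  have gen: "[(k * i mod m) * w = k] (mod m)" if "[w * i = 1] (mod m)" for i m w :: int
  proof -
    have "[(k * i mod m) * w = k * i * w] (mod m)" by (simp add: cong_def mod_mult_left_eq)
    also have "k * i * w = k * (w * i)" by simp
    also have "[k * (w * i) = k * 1] (mod m)" using that by (rule cong_scalar_left)
    finally show ?thesis by simp
  qed
  show "[xd k * (q * r) = k] (mod p)" "[yd k * (p * r) = k] (mod q)" "[zd k * (p * q) = k] (mod r)"
    unfolding xd_def yd_def zd_def using i1 i2 i3 by (auto intro: gen)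
qed

lemma digit_unique:
  fixes x y w m :: int
  assumes "coprime w m" "[x * w = y * w] (mod m)" "0 \<le> x" "x < m" "0 \<le> y" "y < m"
  shows "x = y"
proof -
  have "[x = y] (mod m)" using assms(1,2) cong_mult_rcancel by blast
  thus ?thesis using assms by (simp add: cong_def)
qed

lemma xd_unique: "[x * (q * r) = k] (mod p) \<Longrightarrow> 0 \<le> x \<Longrightarrow> x < p \<Longrightarrow> xd k = x"
  and yd_unique: "[x * (p * r) = k] (mod q) \<Longrightarrow> 0 \<le> x \<Longrightarrow> x < q \<Longrightarrow> yd k = x"
  and zd_unique: "[x * (p * q) = k] (mod r) \<Longrightarrow> 0 \<le> x \<Longrightarrow> x < r \<Longrightarrow> zd k = x"
proof -
  have gen: "d = x" if "coprime w m" "[d * w = k] (mod m)" "[x * w = k] (mod m)" "0 \<le> d" "d < m" "0 \<le> x" "x < m"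
    for d w m x :: int
    using digit_unique[of w m d x] that cong_trans cong_sym by blast
  show "[x * (q * r) = k] (mod p) \<Longrightarrow> 0 \<le> x \<Longrightarrow> x < p \<Longrightarrow> xd k = x"
    using coprimes by (intro gen[of "q * r" p, OF _ xd_cong _ xd_range]) (simp_all add: coprime_commute)
  show "[x * (p * r) = k] (mod q) \<Longrightarrow> 0 \<le> x \<Longrightarrow> x < q \<Longrightarrow> yd k = x"
    using coprimes by (intro gen[of "p * r" q, OF _ yd_cong _ yd_range]) (simp_all add: coprime_commute)
  show "[x * (p * q) = k] (mod r) \<Longrightarrow> 0 \<le> x \<Longrightarrow> x < r \<Longrightarrow> zd k = x"
    using coprimes by (intro gen[of "p * q" r, OF _ zd_cong _ zd_range]) (simp_all add: coprime_commute)
qed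

lemma Gd: "xd k * (q * r) + yd k * (p * r) + zd k * (p * q) = k + Gd k * N"
proof -
  let ?s = "xd k * (q * r) + yd k * (p * r) + zd k * (p * q) - k"
  have "p dvd (xd k * (q * r) - k) + (yd k * r + zd k * q) * p"
    using xd_cong[of k] by (intro dvd_add) (auto simp: cong_iff_dvd_diff)
  hence "p dvd ?s" by (simp add: algebra_simps)
  moreover have "q dvd (yd k * (p * r) - k) + (xd k * r + zd k * p) * q"
    using yd_cong[of k] by (intro dvd_add) (auto simp: cong_iff_dvd_diff)
  hence "q dvd ?s" by (simp add: algebra_simps)
  moreover have "r dvd (zd k * (p * q) - k) + (xd k * q + yd k * p) * r"
    using zd_cong[of k] by (intro dvd_add) (auto simp: cong_iff_dvd_diff)
  hence "r dvd ?s" by (simp add: algebra_simps)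
  ultimately have "p * q * r dvd ?s" using coprimes by (intro divides_mult) (auto simp: coprime_commute)
  hence "?s = Gd k * N" by (simp add: Gd_def N_def)
  thus ?thesis by simp
qed

text \<open>This is the source of the inequalities that restrict \<open>G\<close> in the case
  analysis of the summand.\<close>

lemma Gd_nonneg: "k < N \<Longrightarrow> 0 \<le> Gd k"
proof -
  assume k: "k < N"
  have "0 \<le> xd k * (q * r) + yd k * (p * r) + zd k * (p * q)"
    using xd_range[of k] yd_range[of k] zd_range[of k] p_gt q_gt r_gt by simp
  hence "N * (- 1) < N * Gd k" using k Gd[of k] by (simp add: mult.commute)
  thus ?thesis using N_pos by (simp only: mult_less_cancel_left_pos)
qed

lemma Gd_eqI:
  assumes "x * (q * r) + y * (p * r) + z * (p * q) = k + g * N"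
    "0 \<le> x" "x < p" "0 \<le> y" "y < q" "0 \<le> z" "z < r"
  shows "xd k = x" "yd k = y" "zd k = z" "Gd k = g"
proof -
  have k: "k = x * (q * r) + y * (p * r) + z * (p * q) - g * N" using assms by simp
  have "[x * (q * r) = k] (mod p)" "[y * (p * r) = k] (mod q)" "[z * (p * q) = k] (mod r)"
    unfolding cong_iff_dvd_diff k N_def
    by (simp_all add: dvd_def) (rule exI[of _ "g * (q * r) - y * r - z * q"] exI[of _ "g * (p * r) - x * r - z * p"]
        exI[of _ "g * (p * q) - x * q - y * p"]; simp add: algebra_simps)+
  thus xyz: "xd k = x" "yd k = y" "zd k = z" using assms xd_unique yd_unique zd_unique by auto
  have "Gd k * N = g * N" using Gd[of k] assms(1) unfolding xyz by linarith
  moreover have "N \<noteq> 0" using N_pos by simp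
  ultimately show "Gd k = g" by (simp only: mult_cancel_right) blast
qed

lemma \<chi>_iff: "\<chi> k = of_bool (Gd k = 0)"
proof -
  have "Gd k = 0" if "k = x * (q * r) + y * (p * r) + z * (p * q)"
    "0 \<le> x" "x < p" "0 \<le> y" "y < q" "0 \<le> z" "z < r" for x y z
    using Gd_eqI(4)[of x y z k 0] that by simp
  moreover have "k = xd k * (q * r) + yd k * (p * r) + zd k * (p * q)" if "Gd k = 0"
    using Gd[of k] that by simp
  ultimately show ?thesis using xd_range[of k] yd_range[of k] zd_range[of k] unfolding \<chi>_def
    by (intro arg_cong[of _ _ of_bool]) blast
qed

text \<open>The hypothesis says that \<open>e\<close> has digits \<open>t\<close>, \<open>c\<close>,
  0 and carry 1. Subtracting digit by digit borrows wherever a digit is too small, and each borrow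
  adds \<open>N\<close>.\<close>

lemma shift_y:
  assumes "t * (q * r) + c * (p * r) = e + N" "0 < t" "t < p" "0 < c" "c < q"
  shows "Gd (k - e) = Gd k - 1 + of_bool (xd k < t) + of_bool (yd k < c)"
    "xd (k - e) = (xd k - t) mod p" "zd (k - e) = zd k"
proof -
  define x y where "x = xd k - t + p * of_bool (xd k < t)" and "y = yd k - c + q * of_bool (yd k < c)"
  have "x * (q * r) + y * (p * r) + zd k * (p * q)
      = (k - e) + (Gd k - 1 + of_bool (xd k < t) + of_bool (yd k < c)) * N"
  proof -
    define u v :: int where "u = of_bool (xd k < t)" and "v = of_bool (yd k < c)"
    have "x * (q * r) = xd k * (q * r) - t * (q * r) + u * N" "y * (p * r) = yd k * (p * r) - c * (p * r) + v * N"
      unfolding x_def y_def N_def u_def[symmetric] v_def[symmetric] by (simp_all add: algebra_simps)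
    moreover have "(Gd k - 1 + u + v) * N = Gd k * N - N + u * N + v * N" by (simp add: algebra_simps)
    ultimately show ?thesis using Gd[of k] assms(1) unfolding u_def[symmetric] v_def[symmetric] by linarith
  qed
  note * = Gd_eqI[OF this]
  have r: "0 \<le> x" "x < p" "0 \<le> y" "y < q"
    using xd_range[of k] yd_range[of k] assms by (auto simp: x_def y_def)
  note * = *[OF r zd_range[of k]]
  show "Gd (k - e) = Gd k - 1 + of_bool (xd k < t) + of_bool (yd k < c)" "zd (k - e) = zd k"
    using * by auto
  have "(xd k - t) mod p = x mod p" by (simp add: x_def)
  thus "xd (k - e) = (xd k - t) mod p" using * r by simp
qed

lemma shift_z:
  assumes "s * (q * r) + c * (p * q) = e + N" "0 < s" "s < p" "0 < c" "c < r"
  shows "Gd (k - e) = Gd k - 1 + of_bool (xd k < s) + of_bool (zd k < c)"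
proof -
  define x z where "x = xd k - s + p * of_bool (xd k < s)" and "z = zd k - c + r * of_bool (zd k < c)"
  have "x * (q * r) + yd k * (p * r) + z * (p * q)
      = (k - e) + (Gd k - 1 + of_bool (xd k < s) + of_bool (zd k < c)) * N"
  proof -
    define u v :: int where "u = of_bool (xd k < s)" and "v = of_bool (zd k < c)"
    have "x * (q * r) = xd k * (q * r) - s * (q * r) + u * N" "z * (p * q) = zd k * (p * q) - c * (p * q) + v * N"
      unfolding x_def z_def N_def u_def[symmetric] v_def[symmetric] by (simp_all add: algebra_simps)
    moreover have "(Gd k - 1 + u + v) * N = Gd k * N - N + u * N + v * N" by (simp add: algebra_simps)
    ultimately show ?thesis using Gd[of k] assms(1) unfolding u_def[symmetric] v_def[symmetric] by linarith
  qed
  note * = Gd_eqI(4)[OF this]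
  have r: "0 \<le> x" "x < p" "0 \<le> z" "z < r"
    using xd_range[of k] zd_range[of k] assms by (auto simp: x_def z_def)
  show ?thesis using *[OF r(1,2) yd_range[of k] r(3,4)] .
qed

text \<open>
  The shifts \<open>e\<close> and \<open>e'\<close> are \<open>\<plusminus>r\<close> and \<open>\<plusminus>q\<close>; the signs allow to assume \<open>2 * t < p\<close> and
  \<open>2 * s < p\<close>.
\<close>

lemma count_bounds:
  fixes e e' n s t c c' \<sigma> \<sigma>' :: int
  assumes odd: "odd p" and pr: "p < q" "p < r"
    and e: "t * (q * r) + c * (p * r) = e + N" "0 < t" "2 * t < p" "0 < c" "c < q" "- r \<le> e"
    and e': "s * (q * r) + c' * (p * q) = e' + N" "0 < s" "2 * s < p" "0 < c'" "c' < r" "- q \<le> e'"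
    and \<sigma>: "p dvd t * q - \<sigma>" "p dvd s * r - \<sigma>'" "\<sigma> \<in> {1, -1}" "\<sigma>' \<in> {1, -1}"
    and n: "n < N" "n - e < N" "n - e' < N" "n - e - e' < N"
  defines "S \<equiv> \<Sum>m\<in>{0..<p}. \<chi> (n - m) - \<chi> (n - m - e') - \<chi> (n - m - e) + \<chi> (n - m - e - e')"
  shows "- max s t \<le> S" "S \<le> p - max s t" "S \<le> 2 * min s t + max s t" "3 * S \<le> 2 * p"
proof -
  define mu where "mu X = (n + - (q * r) * X) mod p" for X
  define g where "g X = Gd (n - mu X)" for X
  have mu: "0 \<le> mu X" "mu X < p" for X using p_gt by (simp_all add: mu_def)
  have xmu: "xd (n - mu X) = X" if "0 \<le> X" "X < p" for X
  proof (rule xd_unique)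
    have "[n - mu X = n - (n + - (q * r) * X)] (mod p)"
      unfolding mu_def by (intro cong_diff cong_refl) (simp add: cong_def)
    thus "[X * (q * r) = n - mu X] (mod p)" by (simp add: cong_sym mult.commute)
  qed fact+
  have eta: "(- (p * r) - n * i2 * (p * r) + i2 * (p * r) * mu X) mod N = N - p * r - yd (n - mu X) * (p * r)" for X
  proof -
    have "[(n - mu X) * i2 = yd (n - mu X)] (mod q)" by (simp add: yd_def cong_def)
    hence "q dvd (n - mu X) * i2 - yd (n - mu X)" by (simp only: cong_iff_dvd_diff)
    hence "(p * r) * q dvd (p * r) * ((n - mu X) * i2 - yd (n - mu X))" by (rule mult_dvd_mono[OF dvd_refl])
    moreover have "(p * r) * q = N" by (simp add: N_def)
    ultimately have "N dvd (p * r) * ((n - mu X) * i2 - yd (n - mu X))" by (simp only:)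
    hence "N dvd N + (p * r) * ((n - mu X) * i2 - yd (n - mu X))" by (rule dvd_add[OF dvd_refl])
    hence "[N - p * r - yd (n - mu X) * (p * r) = - (p * r) - n * i2 * (p * r) + i2 * (p * r) * mu X] (mod N)"
      by (simp add: cong_iff_dvd_diff algebra_simps)
    moreover have "0 \<le> (q - 1 - yd (n - mu X)) * (p * r)"
      using yd_range[of "n - mu X"] p_gt r_gt by simp
    hence "0 \<le> N - p * r - yd (n - mu X) * (p * r)" by (simp add: N_def algebra_simps)
    moreover have "0 \<le> yd (n - mu X) * (p * r)" "0 < p * r" using yd_range[of "n - mu X"] p_gt r_gt by auto
    hence "N - p * r - yd (n - mu X) * (p * r) < N" by linarith
    ultimately show ?thesis by (simp add: cong_def)
  qed
  have zeta: "(- (p * q) - n * i3 * (p * q) + i3 * (p * q) * mu X) mod N = N - p * q - zd (n - mu X) * (p * q)" for X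
  proof -
    have "[(n - mu X) * i3 = zd (n - mu X)] (mod r)" by (simp add: zd_def cong_def)
    hence "r dvd (n - mu X) * i3 - zd (n - mu X)" by (simp only: cong_iff_dvd_diff)
    hence "(p * q) * r dvd (p * q) * ((n - mu X) * i3 - zd (n - mu X))" by (rule mult_dvd_mono[OF dvd_refl])
    moreover have "(p * q) * r = N" by (simp add: N_def)
    ultimately have "N dvd (p * q) * ((n - mu X) * i3 - zd (n - mu X))" by (simp only:)
    hence "N dvd N + (p * q) * ((n - mu X) * i3 - zd (n - mu X))" by (rule dvd_add[OF dvd_refl])
    hence "[N - p * q - zd (n - mu X) * (p * q) = - (p * q) - n * i3 * (p * q) + i3 * (p * q) * mu X] (mod N)"
      by (simp add: cong_iff_dvd_diff algebra_simps)
    moreover have "0 \<le> (r - 1 - zd (n - mu X)) * (p * q)"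
      using zd_range[of "n - mu X"] p_gt q_gt by simp
    hence "0 \<le> N - p * q - zd (n - mu X) * (p * q)" by (simp add: N_def algebra_simps)
    moreover have "0 \<le> zd (n - mu X) * (p * q)" "0 < p * q" using zd_range[of "n - mu X"] p_gt q_gt by auto
    hence "N - p * q - zd (n - mu X) * (p * q) < N" by linarith
    ultimately show ?thesis by (simp add: cong_def)
  qed
  have N: "p * (q * r) = N" by (simp add: N_def)
  have tp: "t < p" "s < p" using e(2,3) e'(2,3) by linarith+
  note sy = shift_y[OF e(1,2) tp(1) e(4,5)]
  note sz = shift_z[OF e'(1,2) tp(2) e'(4,5)]
  define ay az where "ay = N - p * r - c * (p * r)" and "az = N - p * q - c' * (p * q)"
  have yl: "ay < N - p * r - y * (p * r) \<longleftrightarrow> y < c" for y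
    using p_gt r_gt by (simp add: ay_def)
  have zl: "az < N - p * q - z * (p * q) \<longleftrightarrow> z < c'" for z
    using p_gt q_gt by (simp add: az_def)
  have g0: "0 \<le> Gd (n - mu X)" "0 \<le> Gd (n - mu X - e)" "0 \<le> Gd (n - mu X - e')" "0 \<le> Gd (n - mu X - e - e')" for X
    using mu[of X] n by (intro Gd_nonneg; linarith)+
  have inv: "xd (n - mu X) = X \<Longrightarrow> Gd (n - mu X - e) = g X - 1 + of_bool (X < t) + of_bool (yd (n - mu X) < c)"
    "xd (n - mu X) = X \<Longrightarrow> Gd (n - mu X - e') = g X - 1 + of_bool (X < s) + of_bool (zd (n - mu X) < c')"
    "xd (n - mu X) = X \<Longrightarrow> Gd (n - mu X - e - e') = g X - 2 + of_bool (X < t) + of_bool (yd (n - mu X) < c)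
       + of_bool ((X - t) mod p < s) + of_bool (zd (n - mu X) < c')" for X
    using sy[of "n - mu X"] sz[of "n - mu X"] sz[of "n - mu X - e"] by (simp_all add: g_def)
  interpret C: shifted_count p "q * r" "n + p * r + p * q" s t ay az n "- (q * r)"
    "- (p * r) - n * i2 * (p * r)" "i2 * (p * r)" "- (p * q) - n * i3 * (p * q)" "i3 * (p * q)" g
  proof (unfold_locales, unfold mu_def[symmetric] N eta zeta yl zl)
    show "odd p" by fact
    have "q * 1 < q * r" using q_gt r_gt by (intro mult_strict_left_mono) auto
    thus "p < q * r" using pr by simp
    show "1 \<le> s" "1 \<le> t" "2 * s < p" "2 * t < p" using e e' by auto
    have "0 \<le> (q - 1 - c) * (p * r)" using e(5) p_gt r_gt by simp
    thus "0 \<le> ay" by (simp add: ay_def N_def algebra_simps)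
    have "0 \<le> (r - 1 - c') * (p * q)" using e'(5) p_gt q_gt by simp
    thus "0 \<le> az" by (simp add: az_def N_def algebra_simps)
    \<comment> \<open>As \<open>p\<close> is below \<open>q\<close> and \<open>r\<close>, the slack
      \<open>p * r\<close> or \<open>p * q\<close> absorbs a negative shift together with the extra
      \<open>p\<close>.\<close>
    have "0 \<le> (p - 2) * r" "0 \<le> (p - 2) * q" using p_gt q_gt r_gt by auto
    hence "p + r \<le> p * r" "p + q \<le> p * q" using pr by (simp_all add: algebra_simps)
    thus "ay + p \<le> t * (q * r)" "az + p \<le> s * (q * r)"
      using e(1,6) e'(1,6) by (simp_all add: ay_def az_def)
    \<comment> \<open>Up to sign, \<open>t\<close> and \<open>s\<close> invert \<open>q\<close> and
      \<open>r\<close> modulo \<open>p\<close>, and the index slope is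
      \<open>- (q * r)\<close>.\<close>
    have "p dvd (t * q - \<sigma>) * (s * r) + \<sigma> * (s * r - \<sigma>')" using \<sigma> by (intro dvd_add dvd_mult dvd_mult2)
    hence d: "p dvd t * q * (s * r) - \<sigma> * \<sigma>'" by (simp add: algebra_simps)
    have "\<sigma> * \<sigma>' = 1 \<or> \<sigma> * \<sigma>' = - 1" using \<sigma> by auto
    thus "p dvd - (q * r) * s * t - 1 \<or> p dvd - (q * r) * s * t + 1"
    proof
      assume "\<sigma> * \<sigma>' = 1"
      hence "p dvd - (t * q * (s * r) - 1)" using d by (simp only: dvd_minus_iff)
      also have "- (t * q * (s * r) - 1) = - (q * r) * s * t + 1" by (simp add: algebra_simps)
      finally show ?thesis ..
    next
      assume "\<sigma> * \<sigma>' = - 1"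
      hence "p dvd - (t * q * (s * r) + 1)" using d by (simp only: dvd_minus_iff) simp
      also have "- (t * q * (s * r) + 1) = - (q * r) * s * t - 1" by (simp add: algebra_simps)
      finally show ?thesis ..
    qed
    fix X :: int assume X: "0 \<le> X" "X < p"
    note x = xmu[OF X]
    show "X * (q * r) = n + p * r + p * q - mu X + (N - p * r - yd (n - mu X) * (p * r))
        + (N - p * q - zd (n - mu X) * (p * q)) + (g X - 2) * N"
      using Gd[of "n - mu X"] by (simp add: x g_def algebra_simps)
    show "0 \<le> g X" using g0 by (simp add: g_def)
    show "0 \<le> g X - 1 + of_bool (X < s) + of_bool (zd (n - mu X) < c')"
      "0 \<le> g X - 1 + of_bool (X < t) + of_bool (yd (n - mu X) < c)"
      "0 \<le> g X - 2 + of_bool (X < t) + of_bool (yd (n - mu X) < c) + of_bool ((X - t) mod p < s) + of_bool (zd (n - mu X) < c')"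
      using inv[OF x] g0[of X] by auto
  qed
  have mm: "C.idx = mu" by (simp add: fun_eq_iff C.idx_def mu_def)
  have NN: "C.N = N" by (simp add: C.N_def N)
  have low: "C.yl X \<longleftrightarrow> yd (n - mu X) < c" "C.zl X \<longleftrightarrow> zd (n - mu X) < c'" for X
    unfolding C.yl_def C.zl_def C.\<eta>_def C.\<zeta>_def mm NN eta zeta yl zl by simp_all
  have fX: "C.f X = \<chi> (n - mu X) - \<chi> (n - mu X - e') - \<chi> (n - mu X - e) + \<chi> (n - mu X - e - e')"
    if "X \<in> {0..<p}" for X
    using inv[OF xmu] that unfolding \<chi>_iff C.f_def low by (simp add: g_def)
  have "C.T = S"
    unfolding C.T_def S_def
  proof (rule sum.reindex_bij_witness[of _ "\<lambda>m. xd (n - m)" mu])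
    fix X assume X: "X \<in> {0..<p}"
    show "xd (n - mu X) = X" using xmu X by simp
    show "mu X \<in> {0..<p}" using mu[of X] by simp
    show "\<chi> (n - mu X) - \<chi> (n - mu X - e') - \<chi> (n - mu X - e) + \<chi> (n - mu X - e - e') = C.f X"
      using fX[OF X] by simp
  next
    fix m assume m: "m \<in> {0..<p}"
    show "xd (n - m) \<in> {0..<p}" using xd_range[of "n - m"] by simp
    have "p dvd xd (n - m) * (q * r) - (n - m)" using xd_cong[of "n - m"] by (simp add: cong_iff_dvd_diff)
    hence "p dvd - (xd (n - m) * (q * r) - (n - m))" by (simp only: dvd_minus_iff)
    hence "p dvd (n + - (q * r) * xd (n - m)) - m" by (simp add: algebra_simps)
    hence "mu (xd (n - m)) = m mod p" unfolding mu_def by (simp only: mod_eq_dvd_iff)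
    thus "mu (xd (n - m)) = m" using m by simp
  qed
  thus "- max s t \<le> S" "S \<le> p - max s t" "S \<le> 2 * min s t + max s t" "3 * S \<le> 2 * p"
    using C.T_ge C.T_le_diff C.T_le_sum C.T_le_two_thirds by (simp_all add: C.\<alpha>_def C.\<beta>_def)
qed

end

section \<open>Reduction to inverses below \<open>p / 2\<close>\<close>

text \<open>Replacing \<open>t\<close> by \<open>p - t\<close> and \<open>c\<close> by
  \<open>q - c\<close> turns \<open>1 + p * q\<close> into \<open>- 1 + p * q\<close>, so only the
  sign of the shift changes.\<close>

lemma half_inverse:
  fixes p q t :: int
  assumes p: "odd p" and q: "1 < q" and t: "0 < t" "t < p" "[t * q = 1] (mod p)"
  obtains c \<sigma> where "min t (p - t) * q + c * p = \<sigma> + p * q" "0 < c" "c < q" "\<sigma> \<in> {1, -1}"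
    "0 < min t (p - t)" "2 * min t (p - t) < p"
proof -
  have "p dvd 1 + p * q - t * q"
    using t(3) by (metis cong_iff_dvd_diff cong_sym diff_add_eq dvd_add dvd_triv_left)
  then obtain c where c: "1 + p * q - t * q = p * c" by (elim dvdE)
  have tq: "1 * q \<le> t * q" "t * q \<le> (p - 1) * q" using t q by (auto intro!: mult_right_mono)
  have "1 < t * q" "t * q < 1 + p * q" using tq q unfolding left_diff_distrib by linarith+
  hence "p * 0 < p * c" "p * c < p * q" unfolding c[symmetric] by simp_all
  hence c0: "0 < c" "c < q" using t by (simp_all only: mult_less_cancel_left_pos)
  have "2 * t \<noteq> p" using p by auto
  then consider "2 * t < p" | "p < 2 * t" by linarith
  thus ?thesis
  proof cases
    case 1
    thus ?thesis using that[of c 1] c c0 t by (simp add: algebra_simps)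
  next
    case 2
    have "(p - t) * q + (q - c) * p = - 1 + p * q" using c by (simp add: algebra_simps)
    thus ?thesis using that[of "q - c" "-1"] 2 c0 t by simp
  qed
qed

context mixed_radix
begin

definition block_sum :: "int \<Rightarrow> int" where
  "block_sum n = (\<Sum>m\<in>{0..<p}. \<chi> (n - m) - \<chi> (n - m - q) - \<chi> (n - m - r) + \<chi> (n - m - q - r))"

lemma block_sum_bounds:
  fixes n s t :: int
  assumes odd: "odd p" and pr: "p < q" "p < r" and n: "n < N"
    and t: "0 < t" "t < p" "[t * q = 1] (mod p)" and s: "0 < s" "s < p" "[s * r = 1] (mod p)"
  defines "a \<equiv> min (min s (p - s)) (min t (p - t))" and "b \<equiv> max (min s (p - s)) (min t (p - t))"
  shows "\<bar>block_sum n\<bar> \<le> p - b" "\<bar>block_sum n\<bar> \<le> 2 * a + b" "3 * \<bar>block_sum n\<bar> \<le> 2 * p"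
proof -
  define t' s' where "t' = min t (p - t)" and "s' = min s (p - s)"
  obtain c \<sigma> where c: "t' * q + c * p = \<sigma> + p * q" "0 < c" "c < q" "\<sigma> \<in> {1, -1}" "0 < t'" "2 * t' < p"
    using half_inverse[OF odd q_gt t] by (auto simp: t'_def)
  obtain c' \<sigma>' where c': "s' * r + c' * p = \<sigma>' + p * r" "0 < c'" "c' < r" "\<sigma>' \<in> {1, -1}" "0 < s'" "2 * s' < p"
    using half_inverse[OF odd r_gt s] by (auto simp: s'_def)
  define e e' where "e = \<sigma> * r" and "e' = \<sigma>' * q"
  \<comment> \<open>A sign -1 reverses a shift. Moving the starting point down by that shift yields
    the same four arguments of \<open>\<chi>\<close>, with signs multiplied by
    \<open>\<sigma> * \<sigma>'\<close>.\<close>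
  define n' where "n' = n - (if \<sigma> = 1 then 0 else r) - (if \<sigma>' = 1 then 0 else q)"
  define S where "S = (\<Sum>m\<in>{0..<p}. \<chi> (n' - m) - \<chi> (n' - m - e') - \<chi> (n' - m - e) + \<chi> (n' - m - e - e'))"
  have 1: "t' * (q * r) + c * (p * r) = e + N"
    using arg_cong[OF c(1), of "\<lambda>x. x * r"] by (simp add: e_def N_def algebra_simps)
  have 2: "s' * (q * r) + c' * (p * q) = e' + N"
    using arg_cong[OF c'(1), of "\<lambda>x. x * q"] by (simp add: e'_def N_def algebra_simps)
  have 3: "- r \<le> e" "- q \<le> e'" using c(4) c'(4) r_gt q_gt by (auto simp: e_def e'_def)
  have "t' * q - \<sigma> = p * (q - c)" "s' * r - \<sigma>' = p * (r - c')" using c(1) c'(1) by (simp_all add: algebra_simps)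
  hence 4: "p dvd t' * q - \<sigma>" "p dvd s' * r - \<sigma>'" by simp_all
  have 5: "n' < N" "n' - e < N" "n' - e' < N" "n' - e - e' < N"
    using n c(4) c'(4) q_gt r_gt by (auto simp: n'_def e_def e'_def)
  note bounds = count_bounds[OF odd pr 1 c(5,6,2,3) 3(1) 2 c'(5,6,2,3) 3(2) 4 c(4) c'(4) 5, folded S_def]
  have "S = \<sigma> * \<sigma>' * block_sum n"
    using c(4) c'(4) unfolding S_def block_sum_def
    by (elim insertE emptyE; simp add: n'_def e_def e'_def algebra_simps sum.distrib sum_subtractf)
  hence "\<bar>block_sum n\<bar> = \<bar>S\<bar>" using c(4) c'(4) by (auto simp: abs_mult)
  moreover have ab: "a = min s' t'" "b = max s' t'" by (simp_all add: a_def b_def s'_def t'_def)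
  ultimately show "\<bar>block_sum n\<bar> \<le> p - b" "\<bar>block_sum n\<bar> \<le> 2 * a + b" "3 * \<bar>block_sum n\<bar> \<le> 2 * p"
    using bounds c(5,6) c'(5,6) by (auto simp: abs_le_iff min_def max_def split: if_splits)
qed

end

section \<open>Coefficients of ternary cyclotomic polynomials\<close>

definition root_poly :: "complex set \<Rightarrow> complex poly" where
  "root_poly Z = (\<Prod>z\<in>Z. [:- z, 1:])"

definition unit_roots :: "nat \<Rightarrow> complex set" where
  "unit_roots n = {z. z ^ n = 1}"

lemma finite_unit_roots: "0 < n \<Longrightarrow> finite (unit_roots n)"
  unfolding unit_roots_def by (rule finite_roots_unity) simp

lemma root_poly_unit_roots:
  assumes "0 < n"
  shows "root_poly (unit_roots n) = monom 1 n - 1"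
proof -
  let ?f = "monom 1 n - 1 :: complex poly"
  have deg: "degree ?f = n" "lead_coeff ?f = 1"
  proof -
    have "degree (- 1 + monom 1 n :: complex poly) = degree (monom 1 n :: complex poly)"
      using assms by (intro degree_add_eq_right) (simp add: degree_monom_eq)
    thus "degree ?f = n" by (simp add: degree_monom_eq)
    thus "lead_coeff ?f = 1" using assms by simp
  qed
  have "rsquarefree ?f"
    unfolding rsquarefree_roots using assms
    by (auto simp: pderiv_diff pderiv_monom poly_monom power_0_left)
  from complex_poly_decompose_rsquarefree[OF this]
  have "(\<Prod>z | poly ?f z = 0. [:- z, 1:]) = ?f" using deg by simp
  moreover have "{z. poly ?f z = 0} = unit_roots n" by (auto simp: unit_roots_def poly_monom)
  ultimately show ?thesis by (simp add: root_poly_def)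
qed

text \<open>The first inclusion follows Euclid's algorithm: \<open>z ^ m = 1\<close> and
  \<open>z ^ n = 1\<close> give \<open>z ^ (m mod n) = 1\<close>.\<close>

lemma unit_roots_Int: "unit_roots m \<inter> unit_roots n = unit_roots (gcd m n)"
proof
  show "unit_roots m \<inter> unit_roots n \<subseteq> unit_roots (gcd m n)"
    by (induction m n rule: gcd_nat_induct)
      (auto simp: unit_roots_def gcd_red_nat[symmetric] subset_iff
        simp del: gcd_red_nat, metis (no_types) div_mult_mod_eq mult_1 power_add power_mult power_one mult.commute)
  show "unit_roots (gcd m n) \<subseteq> unit_roots m \<inter> unit_roots n"
    by (auto simp: unit_roots_def elim!: dvdE[of "gcd m n" m] dvdE[of "gcd m n" n])
      (metis gcd_dvd1 gcd_dvd2 dvd_def power_mult power_one)+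
qed

lemma root_poly_Un_Int:
  "finite A \<Longrightarrow> finite B \<Longrightarrow> root_poly (A \<union> B) * root_poly (A \<inter> B) = root_poly A * root_poly B"
  unfolding root_poly_def by (rule prod.union_inter)

lemma root_poly_Diff: "finite A \<Longrightarrow> B \<subseteq> A \<Longrightarrow> root_poly (A - B) * root_poly B = root_poly A"
  unfolding root_poly_def by (rule prod.subset_diff[symmetric])

lemma cis_power_eq_1_iff:
  assumes "0 < n"
  shows "cis (2 * pi * real k / real n) ^ m = 1 \<longleftrightarrow> n dvd k * m"
proof -
  let ?r = "(k * m) mod n"
  have "cis (2 * pi * real k / real n) ^ m = cis (2 * pi * real (k * m) / real n)"
    by (simp add: DeMoivre mult_ac)
  also have "real (k * m) = real n * real ((k * m) div n) + real ?r"
    by (metis div_mult_mod_eq mult.commute of_nat_add of_nat_mult)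
  also have "cis (2 * pi * (real n * real ((k * m) div n) + real ?r) / real n)
      = cis (2 * pi * real ((k * m) div n)) * cis (2 * pi * real ?r / real n)"
    using assms by (simp add: cis_mult field_simps)
  also have "cis (2 * pi * real ((k * m) div n)) = 1" by (rule cis_multiple_2pi) simp
  finally have eq: "cis (2 * pi * real k / real n) ^ m = cis (2 * pi * real ?r / real n)" by simp
  have inj: "inj_on (\<lambda>k. cis (2 * pi * real k / real n)) {..<n}"
    using bij_betw_roots_unity[OF assms] by (simp add: bij_betw_def)
  have "cis (2 * pi * real ?r / real n) = cis (2 * pi * real 0 / real n) \<longleftrightarrow> ?r = 0"
    by (rule inj_on_eq_iff[OF inj]) (use assms in auto)
  thus ?thesis by (simp add: eq dvd_eq_mod_eq_0)
qed

text \<open>A root of unity of order dividing \<open>p * q * r\<close> is primitive unless its order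
  divides a product of two of the primes.\<close>

lemma cyclotomic_ternary_roots:
  assumes "prime p" "prime q" "prime r" "p \<noteq> q" "p \<noteq> r" "q \<noteq> r"
  shows "cyclotomic (p * q * r) =
    root_poly (unit_roots (p * q * r) - (unit_roots (p * q) \<union> unit_roots (p * r) \<union> unit_roots (q * r)))"
proof -
  define n where "n = p * q * r"
  let ?c = "\<lambda>k. cis (2 * pi * real k / real n)"
  have pos: "0 < p" "0 < q" "0 < r" "1 < p" "1 < q" "1 < r" using assms prime_gt_1_nat prime_gt_0_nat by auto
  have n: "1 < n" unfolding n_def using pos by (intro less_1_mult)
  hence n: "1 < n" "0 < n" by simp_all
  have inj: "inj_on ?c {..<n}" and img: "?c ` {..<n} = unit_roots n"
    using bij_betw_roots_unity[OF n(2)] by (auto simp: bij_betw_def unit_roots_def)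
  have tot: "totatives n \<subseteq> {..<n}" using totatives_less[OF _ n(1)] by auto
  have mem: "?c k \<in> unit_roots (p * q) \<longleftrightarrow> r dvd k" "?c k \<in> unit_roots (p * r) \<longleftrightarrow> q dvd k"
    "?c k \<in> unit_roots (q * r) \<longleftrightarrow> p dvd k" for k
  proof -
    have "n dvd k * (p * q) \<longleftrightarrow> r * (p * q) dvd k * (p * q)" "n dvd k * (p * r) \<longleftrightarrow> q * (p * r) dvd k * (p * r)"
      "n dvd k * (q * r) \<longleftrightarrow> p * (q * r) dvd k * (q * r)" by (simp_all add: n_def mult_ac)
    thus "?c k \<in> unit_roots (p * q) \<longleftrightarrow> r dvd k" "?c k \<in> unit_roots (p * r) \<longleftrightarrow> q dvd k"
    "?c k \<in> unit_roots (q * r) \<longleftrightarrow> p dvd k"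
      using pos n by (simp_all add: unit_roots_def cis_power_eq_1_iff)
  qed
  have cop: "coprime k n \<longleftrightarrow> \<not> p dvd k \<and> \<not> q dvd k \<and> \<not> r dvd k" for k
  proof -
    have "coprime k l \<longleftrightarrow> \<not> l dvd k" if "prime l" for l
      using that prime_imp_coprime[of l k] coprime_absorb_left[of l k] not_prime_unit[of l]
      by (auto simp: coprime_commute)
    thus ?thesis using assms by (simp add: n_def coprime_mult_right_iff)
  qed
  have "?c ` totatives n = unit_roots n - (unit_roots (p * q) \<union> unit_roots (p * r) \<union> unit_roots (q * r))"
  proof
    show "?c ` totatives n \<subseteq> unit_roots n - (unit_roots (p * q) \<union> unit_roots (p * r) \<union> unit_roots (q * r))"
      using tot img by (auto simp: mem in_totatives_iff cop)
    show "unit_roots n - (unit_roots (p * q) \<union> unit_roots (p * r) \<union> unit_roots (q * r)) \<subseteq> ?c ` totatives n"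
    proof
      fix z assume z: "z \<in> unit_roots n - (unit_roots (p * q) \<union> unit_roots (p * r) \<union> unit_roots (q * r))"
      then obtain k where k: "k < n" "z = ?c k" using img by auto
      hence "coprime k n" using z by (auto simp: mem cop)
      moreover from this have "0 < k" using n by (cases k) auto
      ultimately show "z \<in> ?c ` totatives n" using k by (auto simp: in_totatives_iff)
    qed
  qed
  moreover have "cyclotomic n = root_poly (?c ` totatives n)"
    unfolding cyclotomic_def root_poly_def
    using prod.reindex[OF inj_on_subset[OF inj tot], of "\<lambda>z. [:- z, 1:]"] by simp
  ultimately show ?thesis by (simp add: n_def)
qed

text \<open>Inclusion and exclusion over the three sets of non-primitive roots, which intersect
  according to gcds; the denominators stand on the left.\<close>

lemma cyclotomic_ternary:
  fixes p q r :: nat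
  assumes "prime p" "prime q" "prime r" "p \<noteq> q" "p \<noteq> r" "q \<noteq> r"
  shows "cyclotomic (p * q * r) * (monom 1 (p * q) - 1) * (monom 1 (p * r) - 1) * (monom 1 (q * r) - 1) * (monom 1 1 - 1)
    = (monom 1 (p * q * r) - 1) * (monom 1 p - 1) * (monom 1 q - 1) * (monom 1 r - 1)"
proof -
  have pos: "0 < p" "0 < q" "0 < r" using assms prime_gt_0_nat by auto
  have c: "coprime p q" "coprime p r" "coprime q r" using assms primes_coprime by auto
  note c = c c[THEN coprime_commute[THEN iffD1]]
  let ?U = unit_roots and ?R = root_poly
  let ?W = "?U (p * q) \<union> ?U (p * r) \<union> ?U (q * r)"
  have g: "gcd (p * q) (p * r) = p" "gcd (p * q) (q * r) = q" "gcd (p * r) (q * r) = r" "gcd q r = 1"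
  proof -
    show "gcd (p * q) (p * r) = p" using c by (simp add: gcd_mult_distrib_nat[symmetric])
    show "gcd (p * q) (q * r) = q" using c gcd_mult_distrib_nat[of q p r] by (simp add: mult.commute)
    show "gcd (p * r) (q * r) = r" using c gcd_mult_distrib_nat[of r p q] by (simp add: mult.commute)
    show "gcd q r = 1" using c by simp
  qed
  have fin: "finite (?U (p * q))" "finite (?U (p * r))" "finite (?U (q * r))" "finite (?U q)" "finite (?U r)"
    "finite (?U (p * q * r))" using pos by (auto intro!: finite_unit_roots)
  have sub: "?W \<subseteq> ?U (p * q * r)"
  proof -
    have "?U m \<subseteq> ?U n" if "m dvd n" for m n using unit_roots_Int[of m n] that by (auto simp: gcd_nat.absorb1)
    thus ?thesis by (intro Un_least) auto
  qed
  have 1: "?R (?U (p * q) \<union> ?U (p * r)) * ?R (?U p) = ?R (?U (p * q)) * ?R (?U (p * r))"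
    using root_poly_Un_Int[OF fin(1,2)] by (simp add: unit_roots_Int g)
  have "(?U (p * q) \<union> ?U (p * r)) \<inter> ?U (q * r) = ?U q \<union> ?U r"
    by (simp add: Int_Un_distrib2 unit_roots_Int g)
  hence 2: "?R ?W * ?R (?U q \<union> ?U r) = ?R (?U (p * q) \<union> ?U (p * r)) * ?R (?U (q * r))"
    using root_poly_Un_Int[of "?U (p * q) \<union> ?U (p * r)" "?U (q * r)"] fin by simp
  have 3: "?R (?U q \<union> ?U r) * ?R (?U 1) = ?R (?U q) * ?R (?U r)"
    using root_poly_Un_Int[OF fin(4,5)] by (simp add: unit_roots_Int g)
  have 4: "cyclotomic (p * q * r) * ?R ?W = ?R (?U (p * q * r))"
    unfolding cyclotomic_ternary_roots[OF assms] using root_poly_Diff[OF fin(6) sub] .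
  \<comment> \<open>The factor of this union comes from splitting the triple union in two stages; it
    is cancelled at the end.\<close>
  have "?R (?U q \<union> ?U r) \<noteq> 0" using fin by (simp add: root_poly_def)
  moreover have "?R (?U q \<union> ?U r) * (cyclotomic (p * q * r) * ?R (?U (p * q)) * ?R (?U (p * r)) * ?R (?U (q * r)) * ?R (?U 1))
    = ?R (?U q \<union> ?U r) * (?R (?U (p * q * r)) * ?R (?U p) * ?R (?U q) * ?R (?U r))"
  proof -
    have "?R (?U q \<union> ?U r) * (cyclotomic (p * q * r) * ?R (?U (p * q)) * ?R (?U (p * r)) * ?R (?U (q * r)) * ?R (?U 1))
      = cyclotomic (p * q * r) * (?R (?U (p * q)) * ?R (?U (p * r))) * ?R (?U (q * r)) * (?R (?U q \<union> ?U r) * ?R (?U 1))"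
      by (simp only: mult_ac)
    also have "\<dots> = cyclotomic (p * q * r) * (?R (?U (p * q) \<union> ?U (p * r)) * ?R (?U (q * r))) * ?R (?U p) * (?R (?U q) * ?R (?U r))"
      unfolding 1[symmetric] 3 by (simp only: mult_ac)
    also have "\<dots> = (cyclotomic (p * q * r) * ?R ?W) * ?R (?U q \<union> ?U r) * ?R (?U p) * (?R (?U q) * ?R (?U r))"
      unfolding 2[symmetric] by (simp only: mult_ac)
    also have "\<dots> = ?R (?U q \<union> ?U r) * (?R (?U (p * q * r)) * ?R (?U p) * ?R (?U q) * ?R (?U r))"
      unfolding 4 by (simp only: mult_ac)
    finally show ?thesis .
  qed
  ultimately have "cyclotomic (p * q * r) * ?R (?U (p * q)) * ?R (?U (p * r)) * ?R (?U (q * r)) * ?R (?U 1)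
    = ?R (?U (p * q * r)) * ?R (?U p) * ?R (?U q) * ?R (?U r)"
    by (simp only: mult_cancel_left) blast
  thus ?thesis using pos by (simp add: root_poly_unit_roots)
qed

section \<open>Reading off coefficients\<close>

lemma monom_geometric_sum:
  "(monom 1 d - 1) * (\<Sum>a<m. monom 1 (a * d)) = monom 1 (m * d) - (1 :: complex poly)"
  using power_diff_1_eq[of "monom 1 d :: complex poly" m] by (simp add: monom_power mult.commute)

text \<open>Extended by zero to negative indices, so that multiplication by a monomial is a plain
  shift.\<close>

definition coeff_int :: "complex poly \<Rightarrow> int \<Rightarrow> complex" where
  "coeff_int f j = (if j < 0 then 0 else coeff f (nat j))"

lemma coeff_int_simps:
  "coeff_int (f + g) j = coeff_int f j + coeff_int g j" "coeff_int (f - g) j = coeff_int f j - coeff_int g j"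
  "coeff_int (sum h I) j = (\<Sum>i\<in>I. coeff_int (h i) j)"
  by (auto simp: coeff_int_def coeff_sum)

lemma coeff_int_monom_mult: "coeff_int (monom 1 d * f) j = coeff_int f (j - int d)"
  by (auto simp: coeff_int_def coeff_monom_mult nat_diff_distrib nat_less_iff)

text \<open>The product \<open>S\<close> of three geometric sums has coefficients
  \<open>\<chi>\<close>, because digits are unique. Multiplying by the square of
  \<open>monom 1 n - 1\<close> replaces the denominators by \<open>S\<close> and leaves coefficients
  below \<open>n = p * q * r\<close> unchanged.\<close>

lemma coeff_cyclotomic_ternary:
  fixes p q r k :: nat
  assumes pr: "prime p" "prime q" "prime r" "p \<noteq> q" "p \<noteq> r" "q \<noteq> r" and k: "k < p * q * r"
  shows "coeff (cyclotomic (p * q * r)) k = of_int (mixed_radix.block_sum (int p) (int q) (int r) (int k))"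
proof -
  have gt: "1 < p" "1 < q" "1 < r" using pr prime_gt_1_nat by auto
  have "coprime p q" "coprime p r" "coprime q r" using pr primes_coprime by auto
  then interpret R: mixed_radix "int p" "int q" "int r" using gt by unfold_locales auto
  let ?C = "cyclotomic (p * q * r)" and ?m = "\<lambda>d. monom 1 d :: complex poly"
  define n where "n = p * q * r"
  define V where "V = {..<p} \<times> {..<q} \<times> {..<r}"
  define h where "h = (\<lambda>(a, b, c). a * (q * r) + b * (p * r) + c * (p * q))"
  define S where "S = (\<Sum>a<p. ?m (a * (q * r))) * (\<Sum>b<q. ?m (b * (p * r))) * (\<Sum>c<r. ?m (c * (p * q)))"
  have inj: "inj_on h V"
  proof (rule inj_onI)
    fix u v assume u: "u \<in> V" and v: "v \<in> V" and eq: "h u = h v"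
    obtain a b c a' b' c' where uv: "u = (a, b, c)" "v = (a', b', c')" by (cases u, cases v) auto
    have 1: "int a * (int q * int r) + int b * (int p * int r) + int c * (int p * int q) = int (h u) + 0 * R.N"
      by (simp add: uv h_def)
    have 2: "int a' * (int q * int r) + int b' * (int p * int r) + int c' * (int p * int q) = int (h u) + 0 * R.N"
      unfolding eq by (simp add: uv h_def)
    from R.Gd_eqI[OF 1] R.Gd_eqI[OF 2]
    show "u = v" using u v by (simp add: uv V_def)
  qed
  have S: "S = (\<Sum>v\<in>V. ?m (h v))"
  proof -
    have "S = (\<Sum>a<p. ?m (a * (q * r))) * (\<Sum>b<q. \<Sum>c<r. ?m (b * (p * r)) * ?m (c * (p * q)))"
      by (simp only: S_def mult.assoc sum_product[symmetric])
    also have "\<dots> = (\<Sum>a<p. \<Sum>b<q. \<Sum>c<r. ?m (a * (q * r)) * (?m (b * (p * r)) * ?m (c * (p * q))))"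
      by (subst sum_product) (simp only: sum_distrib_left)
    also have "\<dots> = (\<Sum>a<p. \<Sum>b<q. \<Sum>c<r. ?m (h (a, b, c)))"
      by (simp add: mult_monom h_def add.assoc)
    also have "\<dots> = (\<Sum>v\<in>V. ?m (h v))"
      unfolding V_def by (simp add: sum.cartesian_product split_def)
    finally show ?thesis .
  qed
  have coeff_S: "coeff_int S j = of_int (R.\<chi> j)" for j
  proof (cases "j < 0")
    case True
    have "j \<noteq> x * (int q * int r) + y * (int p * int r) + z * (int p * int q)" if "0 \<le> x" "0 \<le> y" "0 \<le> z" for x y z
    proof -
      have "0 \<le> x * (int q * int r) + y * (int p * int r) + z * (int p * int q)" using that by simp
      thus ?thesis using True by linarith
    qed
    hence "R.\<chi> j = 0" unfolding R.\<chi>_def by simp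
    thus ?thesis using True by (simp add: coeff_int_def)
  next
    case False
    have "coeff S (nat j) = (\<Sum>v\<in>V. if h v = nat j then 1 else 0)" by (simp add: S coeff_sum)
    also have "\<dots> = (\<Sum>i\<in>h ` V. if i = nat j then 1 else 0)" by (simp add: sum.reindex[OF inj])
    also have "\<dots> = of_bool (nat j \<in> h ` V)" by (simp add: V_def)
    also have "nat j \<in> h ` V \<longleftrightarrow> (\<exists>x y z. 0 \<le> x \<and> x < int p \<and> 0 \<le> y \<and> y < int q \<and> 0 \<le> z \<and> z < int r
      \<and> j = x * (int q * int r) + y * (int p * int r) + z * (int p * int q))" (is "_ \<longleftrightarrow> ?ex")
    proof
      assume "nat j \<in> h ` V"
      then obtain a b c where abc: "a < p" "b < q" "c < r" "nat j = a * (q * r) + b * (p * r) + c * (p * q)"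
        by (auto simp: h_def V_def)
      have "j = int (nat j)" using False by simp
      also have "\<dots> = int a * (int q * int r) + int b * (int p * int r) + int c * (int p * int q)"
        unfolding abc(4) by simp
      finally show ?ex using abc(1-3) by (intro exI[of _ "int a"] exI[of _ "int b"] exI[of _ "int c"]) simp
    next
      assume ?ex
      then obtain x y z where xyz: "0 \<le> x" "x < int p" "0 \<le> y" "y < int q" "0 \<le> z" "z < int r"
        "j = x * (int q * int r) + y * (int p * int r) + z * (int p * int q)" by blast
      hence "j = int (h (nat x, nat y, nat z))" by (simp add: h_def)
      hence "nat j = h (nat x, nat y, nat z)" by simp
      thus "nat j \<in> h ` V" using xyz by (auto simp: V_def)
    qed
    finally show ?thesis using False by (simp add: coeff_int_def R.\<chi>_def)
  qed
  have S_eq: "(?m (p * q) - 1) * (?m (p * r) - 1) * (?m (q * r) - 1) * S = (?m n - 1) * (?m n - 1) * (?m n - 1)"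
  proof -
    have "(?m (p * q) - 1) * (?m (p * r) - 1) * (?m (q * r) - 1) * S
      = ((?m (q * r) - 1) * (\<Sum>a<p. ?m (a * (q * r)))) * ((?m (p * r) - 1) * (\<Sum>b<q. ?m (b * (p * r))))
        * ((?m (p * q) - 1) * (\<Sum>c<r. ?m (c * (p * q))))"
      unfolding S_def by (simp only: mult_ac)
    thus ?thesis by (simp only: monom_geometric_sum n_def mult_ac)
  qed
  have mp: "?m p - 1 = (?m 1 - 1) * (\<Sum>i<p. ?m i)" using monom_geometric_sum[of 1 p] by simp
  have nz: "?m n - 1 \<noteq> 0" "?m 1 - 1 \<noteq> 0"
  proof -
    have "coeff (?m d - 1) 0 = - 1" if "0 < d" for d using that by simp
    moreover have "0 < n" using gt by (simp add: n_def)
    ultimately show "?m n - 1 \<noteq> 0" "?m 1 - 1 \<noteq> 0" by (metis coeff_0 neg_equal_0_iff_equal zero_neq_one zero_less_one)+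
  qed
  have "((?m n - 1) * (?m 1 - 1)) * (?C * (?m n - 1) * (?m n - 1))
      = (?C * (?m (p * q) - 1) * (?m (p * r) - 1) * (?m (q * r) - 1) * (?m 1 - 1)) * S"
  proof -
    have "((?m n - 1) * (?m 1 - 1)) * (?C * (?m n - 1) * (?m n - 1))
      = ?C * ((?m n - 1) * (?m n - 1) * (?m n - 1)) * (?m 1 - 1)" by (simp only: mult_ac)
    thus ?thesis unfolding S_eq[symmetric] by (simp only: mult_ac)
  qed
  also have "\<dots> = ((?m n - 1) * ((?m 1 - 1) * (\<Sum>i<p. ?m i)) * (?m q - 1) * (?m r - 1)) * S"
    unfolding cyclotomic_ternary[OF pr] n_def mp ..
  also have "\<dots> = ((?m n - 1) * (?m 1 - 1)) * ((\<Sum>i<p. ?m i) * (?m q - 1) * (?m r - 1) * S)"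
    by (simp only: mult_ac)
  finally have main: "?C * (?m n - 1) * (?m n - 1) = (\<Sum>i<p. ?m i) * (?m q - 1) * (?m r - 1) * S"
    using nz by (simp only: mult_cancel_left mult_eq_0_iff) blast
  have c1: "coeff_int (?C * (?m n - 1) * (?m n - 1)) (int k) = coeff ?C k"
  proof -
    have "?C * (?m n - 1) * (?m n - 1) = ?m n * (?m n * ?C) - ?m n * ?C - ?m n * ?C + ?C"
      by (simp add: algebra_simps)
    moreover have "coeff_int f (int k - int n) = 0" "coeff_int f (int k - int n - int n) = 0" for f :: "complex poly"
    proof -
      have "int k < int n" using k by (simp only: n_def of_nat_less_iff)
      thus "coeff_int f (int k - int n) = 0" "coeff_int f (int k - int n - int n) = 0"
        by (simp_all add: coeff_int_def)
    qed
    ultimately show ?thesis by (simp only: coeff_int_simps coeff_int_monom_mult) (simp add: coeff_int_def)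
  qed
  have "(?m q - 1) * (?m r - 1) * S = ?m q * (?m r * S) - ?m q * S - ?m r * S + S"
    by (simp add: algebra_simps)
  hence "(\<Sum>i<p. ?m i) * (?m q - 1) * (?m r - 1) * S
      = (\<Sum>i<p. ?m i * (?m q * (?m r * S) - ?m q * S - ?m r * S + S))"
    by (simp only: sum_distrib_right[symmetric] mult.assoc)
  hence c2: "coeff_int ((\<Sum>i<p. ?m i) * (?m q - 1) * (?m r - 1) * S) (int k)
      = (\<Sum>i<p. of_int (R.\<chi> (int k - int i - int q - int r)) - of_int (R.\<chi> (int k - int i - int q))
          - of_int (R.\<chi> (int k - int i - int r)) + of_int (R.\<chi> (int k - int i)))"
    by (simp only: coeff_int_simps coeff_int_monom_mult coeff_S)
  have c3: "R.block_sum (int k) = (\<Sum>i<p. R.\<chi> (int k - int i) - R.\<chi> (int k - int i - int q)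
      - R.\<chi> (int k - int i - int r) + R.\<chi> (int k - int i - int q - int r))"
    unfolding R.block_sum_def
    by (rule sum.reindex_bij_witness[of _ int nat]) auto
  show ?thesis unfolding c1[symmetric] main c2 c3 by (simp add: algebra_simps)
qed

section \<open>From block sums to heights\<close>

text \<open>The number \<open>s\<close> belongs to the largest prime \<open>r\<close> and must be
  eliminated. For \<open>4 * t < p\<close>, use the second bound if \<open>s \<le> t\<close> and
  otherwise the average of the first two; for larger \<open>t\<close> the first bound
  suffices.\<close>

lemma le_m_bound:
  fixes p j :: nat and s h :: int
  assumes p: "odd p" and j: "1 \<le> j" "j < p" and s: "0 < s" "2 * s < int p"
    and t: "t = min (int j) (int p - int j)"
    and h: "h \<le> int p - max s t" "h \<le> 2 * min s t + max s t" "3 * h \<le> 2 * int p"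
  shows "real_of_int h \<le> m_bound p j"
proof -
  obtain k where k: "p = 2 * k + 1" using p by (auto elim: oddE)
  have low: "real_of_int h \<le> w_low p i" if i: "int i = t" for i
  proof (cases "real i < real p / 4")
    case True
    hence "4 * int i < int p" by linarith
    hence "h \<le> int k + int i" using h s k i by (auto simp: min_def max_def split: if_splits)
    thus ?thesis using True k by (simp add: w_low_def)
  next
    case False
    have "h \<le> int p - int i" using h i by simp
    thus ?thesis using False by (simp add: w_low_def)
  qed
  have "real_of_int h \<le> w_bound p j"
  proof (cases "real j \<le> (real p - 1) / 2")
    case True
    hence "real j \<le> real k" using k by simp
    hence "int j \<le> int p - int j" using k by simp
    thus ?thesis using low[of j] True t by (simp add: w_bound_def)
  next
    case False
    hence "int (p - j) = t" using k j t by (auto simp: min_def of_nat_diff)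
    thus ?thesis using low[of "p - j"] False by (simp add: w_bound_def)
  qed
  moreover have "h \<le> \<lfloor>2 / 3 * real p\<rfloor>" using h(3) by (subst le_floor_iff) linarith
  ultimately show ?thesis by (simp add: m_bound_def)
qed

text \<open>Membership in a finite set independent of \<open>q\<close> and \<open>r\<close> makes
  the maxima over infinitely many primes meaningful.\<close>

lemma height_ternary:
  fixes p q r j :: nat
  assumes pr: "prime p" "prime q" "prime r" "odd p" "p < q" "q < r"
    and j: "1 \<le> j" "j < p" "[q * j = 1] (mod p)"
  shows "height (p * q * r) \<in> real ` {..p}" "height (p * q * r) \<le> m_bound p j"
proof -
  have ne: "p \<noteq> q" "p \<noteq> r" "q \<noteq> r" using pr by auto
  have gt: "1 < p" "1 < q" "1 < r" using pr prime_gt_1_nat by auto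
  have cop: "coprime p q" "coprime p r" "coprime q r"
    using primes_coprime[OF pr(1,2) ne(1)] primes_coprime[OF pr(1,3) ne(2)] primes_coprime[OF pr(2,3) ne(3)] .
  then interpret R: mixed_radix "int p" "int q" "int r" using gt by unfold_locales auto
  have N: "1 < p * q * r" using gt by (intro less_1_mult)
  obtain s0 where s0: "[int r * s0 = 1] (mod int p)"
    using cong_solve_coprime_int[of "int r" "int p"] cop by (auto simp: coprime_commute)
  define s where "s = s0 mod int p"
  have s: "[s * int r = 1] (mod int p)" using s0 by (simp add: s_def cong_def mod_mult_right_eq mult.commute)
  have "s \<noteq> 0" using s gt by (auto simp: cong_def)
  moreover have "0 \<le> s" "s < int p" using gt by (simp_all add: s_def)
  ultimately have sr: "0 < s" "s < int p" by linarith+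
  have "[int (q * j) = int 1] (mod int p)" using j(3) by (simp only: cong_int_iff)
  hence jq: "[int j * int q = 1] (mod int p)" by (simp add: mult.commute)
  define s' t where "s' = min s (int p - s)" and "t = min (int j) (int p - int j)"
  have s': "0 < s'" "2 * s' < int p"
  proof -
    have "2 * s \<noteq> int p" using pr(4) by (metis even_mult_iff even_of_nat_iff even_numeral)
    thus "0 < s'" "2 * s' < int p" using sr by (auto simp: s'_def min_def)
  qed
  have bnd: "\<bar>R.block_sum (int k)\<bar> \<le> int p" "real_of_int \<bar>R.block_sum (int k)\<bar> \<le> m_bound p j"
    if k: "k < p * q * r" for k
  proof -
    have "int k < int (p * q * r)" using k by (simp only: of_nat_less_iff)
    hence kN: "int k < R.N" by (simp add: R.N_def)
    have b: "\<bar>R.block_sum (int k)\<bar> \<le> int p - max s' t" "\<bar>R.block_sum (int k)\<bar> \<le> 2 * min s' t + max s' t"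
      "3 * \<bar>R.block_sum (int k)\<bar> \<le> 2 * int p"
      unfolding s'_def t_def using pr j jq sr s kN by (intro R.block_sum_bounds; simp)+
    show "\<bar>R.block_sum (int k)\<bar> \<le> int p" using b s' by linarith
    show "real_of_int \<bar>R.block_sum (int k)\<bar> \<le> m_bound p j"
      by (rule le_m_bound[OF pr(4) j(1,2) s' t_def b])
  qed
  let ?H = "{cmod (coeff (cyclotomic (p * q * r)) k) |k. k \<le> totient (p * q * r)}"
  have "finite ?H" "?H \<noteq> {}" by auto
  hence "Max ?H \<in> ?H" by (rule Max_in)
  then obtain k where k: "k \<le> totient (p * q * r)" "height (p * q * r) = cmod (coeff (cyclotomic (p * q * r)) k)"
    by (auto simp: height_def)
  have "k < p * q * r" using k totient_less[OF N] by linarith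
  hence eq: "height (p * q * r) = real_of_int \<bar>R.block_sum (int k)\<bar>"
    using k coeff_cyclotomic_ternary[OF pr(1-3) ne] by simp
  show "height (p * q * r) \<le> m_bound p j" unfolding eq using bnd \<open>k < p * q * r\<close> by blast
  have "height (p * q * r) = real (nat \<bar>R.block_sum (int k)\<bar>)" unfolding eq by simp
  moreover have "nat \<bar>R.block_sum (int k)\<bar> \<in> {..p}" using bnd(1)[OF \<open>k < p * q * r\<close>] by simp
  ultimately show "height (p * q * r) \<in> real ` {..p}" by blast
qed

theorem theorem4p3:
  fixes p q \<beta> \<beta>' :: nat
  assumes "prime p" and "odd p" and "prime q" and "p < q"
    and "\<beta> \<in> {1..p - 1}" and "[q = \<beta>] (mod p)"
    and "\<beta>' \<in> {1..p - 1}" and "[\<beta> * \<beta>' = 1] (mod p)"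
  shows "max_height_pq p q \<le> max_height_residue \<beta> p \<and>
    max_height_residue \<beta> p \<le> m_bound p \<beta>'"
proof -
  have pos: "0 < p" using assms(1) prime_gt_0_nat by blast
  have j: "1 \<le> \<beta>'" "\<beta>' < p" using assms(7) pos by auto
  have key: "max_height_pq p q' \<in> real ` {..p}" "max_height_pq p q' \<le> m_bound p \<beta>'"
    if q': "prime q'" "p < q'" "[q' = \<beta>] (mod p)" for q'
  proof -
    have "[q' * \<beta>' = \<beta> * \<beta>'] (mod p)" using q'(3) by (rule cong_scalar_right)
    hence c: "[q' * \<beta>' = 1] (mod p)" using assms(8) cong_trans by blast
    let ?S = "{height (p * q' * r) |r. prime r \<and> r > q'}"
    have "?S \<subseteq> real ` {..p}" using height_ternary(1)[OF assms(1) q'(1) _ assms(2) q'(2) _ j c] by blast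
    moreover from this have "finite ?S" by (rule finite_subset) simp
    moreover obtain r where "prime r" "q' < r" using bigger_prime by blast
    hence "?S \<noteq> {}" by blast
    ultimately have "max_height_pq p q' \<in> ?S" "?S \<subseteq> real ` {..p}"
      unfolding max_height_pq_def using Max_in[of ?S] by blast+
    moreover have "x \<le> m_bound p \<beta>'" if "x \<in> ?S" for x
      using that height_ternary(2)[OF assms(1) q'(1) _ assms(2) q'(2) _ j c] by blast
    ultimately show "max_height_pq p q' \<in> real ` {..p}" "max_height_pq p q' \<le> m_bound p \<beta>'" by blast+
  qed
  let ?M = "{max_height_pq p q' |q'. prime q' \<and> q' > p \<and> [q' = \<beta>] (mod p)}"
  have "?M \<subseteq> real ` {..p}" using key(1) by blast
  hence fin: "finite ?M" by (rule finite_subset) simp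
  have mem: "max_height_pq p q \<in> ?M" using assms by blast
  show ?thesis
  proof
    show "max_height_pq p q \<le> max_height_residue \<beta> p"
      unfolding max_height_residue_def using fin mem by (rule Max_ge)
    show "max_height_residue \<beta> p \<le> m_bound p \<beta>'"
      unfolding max_height_residue_def using fin mem key(2) by (intro Max.boundedI) auto
  qed
qed

end
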